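(* Let $\Gamma$ be a finite simple graph with $n$ vertices, let $m \in \{1,\dots,n\}$, and suppose that $\Gamma$ has an $m$-nexus and that $\mu_m(\Gamma) = d_m(\Gamma) - m + 2 \geqslant 1$. Then one of the following must hold. (1) $\mu_m(\Gamma) = 1$ and $\Gamma$ is $K_m$ with $p$ pendant vertices attached to a vertex of $K_m$, for some integer $p \geqslant 0$. (2) $\mu_m(\Gamma) \geqslant 2$ and $\Gamma$ is $K_m$ with $\mu_m(\Gamma) - 1$ pendant vertices attached to each vertex of $K_m$. (3) $m = 2$, $\mu_m(\Gamma) = d$ for some integer $d \geqslant 2$, and $\Gamma$ is $K_{2,d}$.
   Context: All graphs are finite and simple. The Laplacian matrix of a graph $\Gamma$ is $L(\Gamma)=D-A$, where $A$ is the adjacency matrix and $D$ is the diagonal matrix of vertex degrees; its eigenvalues are the Laplacian eigenvalues of $\Gamma$. For $\Gamma$ with $n$ vertices, $d_i(\Gamma)$ and $\mu_i(\Gamma)$ denote respectively the $i$-th largest vertex degree and the $i$-th largest Laplacian eigenvalue of $\Gamma$, counted with multiplicity, so $d_1 \geqslant \dots \geqslant d_n$ and $\mu_1 \geqslant \dots \geqslant \mu_n = 0$. An $m$-nexus of a graph $\Gamma$ without isolated vertices is an $m$-element subset $S$ of the vertex set $V(\Gamma)$ such that each vertex in $S$ has degree at least $d_m(\Gamma)$ and every edge of $\Gamma$ has at least one endpoint in $S$. (In particular, a graph having an $m$-nexus has no isolated vertices.) Attaching $k$ pendant vertices to a vertex $v$ of a graph means adding $k$ new vertices, each joined by an edge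 to $v$ and to no other vertex. $K_m$ is the complete graph on $m$ vertices and $K_{2,d}$ is the complete bipartite graph with parts of sizes $2$ and $d$. "$\Gamma$ is $G$" means $\Gamma$ is isomorphic to $G$. *)

theory Defs
  imports
    "Graph_Theory.Pair_Digraph"
    "Graph_Theory.Digraph_Isomorphism"
    "Graph_Theory.Kuratowski"
    "Jordan_Normal_Form.Char_Poly"
begin

text \<open>
  A finite simple graph is a \<^locale>\<open>pair_graph\<close>: a finite loop-free digraph whose arc relation
  is symmetric, each undirected edge being represented by its two orientations. Hence the degree of
  a vertex is its \<^const>\<open>out_degree\<close>.
\<close>

text \<open>Counting starts at 1 and respects multiplicity; the value is meaningful for \<open>1 \<le> i \<le> size M\<close>.\<close>

definition nth_largest :: "'a::linorder multiset \<Rightarrow> nat \<Rightarrow> 'a" where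
  "nth_largest M i = rev (sorted_list_of_multiset M) ! (i - 1)"

definition degree_seq :: "'a pair_pre_digraph \<Rightarrow> nat \<Rightarrow> nat" where
  "degree_seq G i = nth_largest (image_mset (out_degree (with_proj G)) (mset_set (pverts G))) i"

definition adjacency_mat :: "'a pair_pre_digraph \<Rightarrow> 'a list \<Rightarrow> real mat" where
  "adjacency_mat G vs =
     mat (length vs) (length vs) (\<lambda>(i, j). if (vs ! i, vs ! j) \<in> parcs G then 1 else 0)"

definition degree_mat :: "'a pair_pre_digraph \<Rightarrow> 'a list \<Rightarrow> real mat" where
  "degree_mat G vs =
     mat (length vs) (length vs)
       (\<lambda>(i, j). if i = j then real (out_degree (with_proj G) (vs ! i)) else 0)"

definition laplacian_mat :: "'a pair_pre_digraph \<Rightarrow> 'a list \<Rightarrow> real mat" where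
  "laplacian_mat G vs = degree_mat G vs - adjacency_mat G vs"

text \<open>
  The rows and columns are ordered by an arbitrary enumeration of the vertices; the lemma
  \<open>char_poly_laplacian_mat_cong\<close> below shows that the choice is immaterial.
\<close>

definition laplacian_spectrum :: "'a pair_pre_digraph \<Rightarrow> real multiset" where
  "laplacian_spectrum G =
     proots (char_poly (laplacian_mat G (SOME vs. distinct vs \<and> set vs = pverts G)))"

definition laplacian_eigenvalue :: "'a pair_pre_digraph \<Rightarrow> nat \<Rightarrow> real" where
  "laplacian_eigenvalue G i = nth_largest (laplacian_spectrum G) i"

definition nexus :: "'a pair_pre_digraph \<Rightarrow> nat \<Rightarrow> 'a set \<Rightarrow> bool" where
  "nexus G m S \<longleftrightarrow>
     (\<forall>v\<in>pverts G. out_degree (with_proj G) v \<noteq> 0) \<and>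
     S \<subseteq> pverts G \<and> card S = m \<and>
     (\<forall>v\<in>S. degree_seq G m \<le> out_degree (with_proj G) v) \<and>
     (\<forall>(u, v)\<in>parcs G. u \<in> S \<or> v \<in> S)"

text \<open>Attaches \<open>k v\<close> pendant vertices, namely \<open>Inr (v, i)\<close> for \<open>i < k v\<close>, to each vertex \<open>v\<close>.\<close>

definition attach_pendants ::
  "'a pair_pre_digraph \<Rightarrow> ('a \<Rightarrow> nat) \<Rightarrow> ('a + 'a \<times> nat) pair_pre_digraph" where
  "attach_pendants G k =
     \<lparr> pverts = Inl ` pverts G \<union> {Inr (v, i) | v i. v \<in> pverts G \<and> i < k v},
       parcs = {(Inl u, Inl v) | u v. (u, v) \<in> parcs G}
             \<union> {(Inl v, Inr (v, i)) | v i. v \<in> pverts G \<and> i < k v}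
             \<union> {(Inr (v, i), Inl v) | v i. v \<in> pverts G \<and> i < k v} \<rparr>"

lemma char_poly_laplacian_mat_cong:
  assumes "distinct vs" "distinct ws" "set vs = set ws"
  shows "char_poly (laplacian_mat G vs) = char_poly (laplacian_mat G ws)"
proof -
  define n where "n = length vs"
  have n: "length ws = n"
    unfolding n_def using assms by (metis distinct_card)
  define Q :: "'a list \<Rightarrow> 'a list \<Rightarrow> real mat" where
    "Q xs ys = mat n n (\<lambda>(i, j). if xs ! i = ys ! j then 1 else 0)" for xs ys
  have ex: "\<exists>k<n. ys ! k = x" if "x \<in> set ys" "length ys = n" for x ys
    using that by (metis in_set_conv_nth)
  have lookup: "(\<Sum>k<n. if ys ! k = x then f k else 0) = f l"
    if "distinct ys" "length ys = n" "l < n" "ys ! l = x" for ys x l and f :: "nat \<Rightarrow> real"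
  proof -
    have "(\<Sum>k<n. if ys ! k = x then f k else 0) = (\<Sum>k<n. if k = l then f k else 0)"
      using that by (intro sum.cong) (auto simp: nth_eq_iff_index_eq)
    then show ?thesis using that by simp
  qed
  have inv: "Q xs ys * Q ys xs = 1\<^sub>m n"
    if xs: "distinct xs" "length xs = n" and ys: "distinct ys" "length ys = n"
      and eq: "set xs = set ys" for xs ys
  proof (rule eq_matI)
    fix i j assume "i < dim_row (1\<^sub>m n :: real mat)" "j < dim_col (1\<^sub>m n :: real mat)"
    then have ij: "i < n" "j < n" by auto
    obtain l where l: "l < n" "ys ! l = xs ! i" using ex[of "xs ! i" ys] nth_mem[of i xs] ij xs ys eq by auto
    have "(Q xs ys * Q ys xs) $$ (i, j) =
        (\<Sum>k<n. if ys ! k = xs ! i then (if ys ! k = xs ! j then 1 else 0) else 0)"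
      using ij by (auto simp: Q_def scalar_prod_def lessThan_atLeast0 intro!: sum.cong)
    also have "\<dots> = (if ys ! l = xs ! j then 1 else 0)"
      using lookup[OF ys l] by simp
    also have "\<dots> = (1\<^sub>m n) $$ (i, j)"
      using ij l xs by (simp add: nth_eq_iff_index_eq)
    finally show "(Q xs ys * Q ys xs) $$ (i, j) = (1\<^sub>m n) $$ (i, j)" .
  qed (auto simp: Q_def)
  define L where "L u v = (if u = v then real (out_degree (with_proj G) u) else 0)
      - (if (u, v) \<in> parcs G then 1 else (0::real))" for u v
  have lap: "laplacian_mat G xs = mat n n (\<lambda>(i, j). L (xs ! i) (xs ! j))"
    if "distinct xs" "length xs = n" for xs
    using that by (intro eq_matI)
      (auto simp: laplacian_mat_def degree_mat_def adjacency_mat_def L_def nth_eq_iff_index_eq)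
  have "laplacian_mat G vs * Q vs ws = Q vs ws * laplacian_mat G ws"
  proof (rule eq_matI)
    fix i j
    assume "i < dim_row (Q vs ws * laplacian_mat G ws)" "j < dim_col (Q vs ws * laplacian_mat G ws)"
    then have ij: "i < n" "j < n" using lap[OF assms(2) n] by (auto simp: Q_def)
    have mem: "ws ! j \<in> set vs" "vs ! i \<in> set ws"
      using nth_mem[of j ws] nth_mem[of i vs] ij
      unfolding n n_def[symmetric] assms(3) by simp_all
    obtain l where l: "l < n" "vs ! l = ws ! j"
      using ex[OF mem(1) n_def[symmetric]] by blast
    obtain k where k: "k < n" "ws ! k = vs ! i"
      using ex[OF mem(2) n] by blast
    have "(laplacian_mat G vs * Q vs ws) $$ (i, j) =
        (\<Sum>k<n. if vs ! k = ws ! j then L (vs ! i) (vs ! k) else 0)"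
      using ij lap[OF assms(1) n_def[symmetric]]
      by (auto simp: Q_def scalar_prod_def lessThan_atLeast0 intro!: sum.cong)
    also have "\<dots> = L (vs ! i) (ws ! j)"
      using lookup[OF assms(1) n_def[symmetric] l] l by simp
    also have "\<dots> = (\<Sum>k<n. if ws ! k = vs ! i then L (ws ! k) (ws ! j) else 0)"
      using lookup[OF assms(2) n k] k by simp
    also have "\<dots> = (Q vs ws * laplacian_mat G ws) $$ (i, j)"
      using ij lap[OF assms(2) n]
      by (auto simp: Q_def scalar_prod_def lessThan_atLeast0 intro!: sum.cong)
    finally show "(laplacian_mat G vs * Q vs ws) $$ (i, j) = (Q vs ws * laplacian_mat G ws) $$ (i, j)" .
  qed (auto simp: Q_def lap[OF assms(1) n_def[symmetric]] lap[OF assms(2) n])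
  moreover have car: "laplacian_mat G vs \<in> carrier_mat n n" "laplacian_mat G ws \<in> carrier_mat n n"
    "Q vs ws \<in> carrier_mat n n" "Q ws vs \<in> carrier_mat n n"
    by (auto simp: lap[OF assms(1) n_def[symmetric]] lap[OF assms(2) n] Q_def)
  ultimately have comm: "laplacian_mat G vs * Q vs ws = Q vs ws * laplacian_mat G ws"
    by simp
  have inv1: "Q vs ws * Q ws vs = 1\<^sub>m n" and inv2: "Q ws vs * Q vs ws = 1\<^sub>m n"
    using inv[OF assms(1) n_def[symmetric] assms(2) n assms(3)]
      inv[OF assms(2) n assms(1) n_def[symmetric] assms(3)[symmetric]] .
  have "laplacian_mat G vs = laplacian_mat G vs * (Q vs ws * Q ws vs)"
    unfolding inv1 using car(1) by simp
  also have "\<dots> = laplacian_mat G vs * Q vs ws * Q ws vs"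
    using assoc_mult_mat[OF car(1) car(3) car(4)] by simp
  finally have "laplacian_mat G vs = Q vs ws * laplacian_mat G ws * Q ws vs"
    unfolding comm .
  then have "similar_mat_wit (laplacian_mat G vs) (laplacian_mat G ws) (Q vs ws) (Q ws vs)"
    by (rule similar_mat_witI[OF inv1 inv2 _ car])
  then have "similar_mat (laplacian_mat G vs) (laplacian_mat G ws)"
    unfolding similar_mat_def by blast
  then show ?thesis by (rule char_poly_similar)
qed

end

theory Submission
  imports
    Defs
    "Jordan_Normal_Form.Schur_Decomposition"
    "HOL-Computational_Algebra.Fundamental_Theorem_Algebra"
begin

text \<open>
  Let \<open>S\<close> be an \<open>m\<close>-nexus, \<open>T\<close> the independent set of the other vertices, \<open>d = d\<^sub>m\<close>,
  \<open>e = d - m + 1 \<ge> 0\<close> and \<open>t = e + 1 = \<mu>\<^sub>m\<close>. A vertex of \<open>S\<close> that misses \<open>c\<close> of the other vertices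
  of \<open>S\<close> has at least \<open>e + c\<close> neighbours in \<open>T\<close>, which is how the degrees enter.

  The engine is the equality case of the Courant--Fischer principle. If \<open>\<mu>\<^sub>m \<le> t\<close>, then any
  \<open>card T\<close> linear conditions are satisfied by a nonzero function \<open>x\<close> on the vertices whose Laplacian
  energy is at most \<open>t\<close> times its squared norm, and if the energy equals that bound then \<open>x\<close> is an
  eigenvector for \<open>t\<close> (\<open>laplacian_test_function\<close>). Imposing one condition per vertex of \<open>T\<close> leaves an
  \<open>m\<close>-dimensional space of functions. The conditions are chosen so that on this space the energy
  surplus over \<open>t\<close> is visibly a sum of squares; hence all these squares vanish, and this
  determines the graph.

  If \<open>e \<ge> 1\<close>, each vertex of \<open>S\<close> selects exactly \<open>e + c\<close> of its neighbours in \<open>T\<close>, and \<open>x\<close> is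
  required to be \<open>- 1 / e\<close> times the mean of \<open>x\<close> over \<open>S\<close> at each selected vertex and \<open>0\<close> at the
  rest of \<open>T\<close>. This is what the eigenvectors of the extremal graphs look like. The surplus then splits
  over the pairs of vertices of \<open>S\<close>, the unselected edges and the repeated selections
  (\<open>surplus_identity\<close>). If the mean is nonzero, \<open>S\<close> is a clique and all its outer neighbours are
  distinct pendant vertices; if it is zero, \<open>S\<close> is a pair of nonadjacent vertices, and the eigenvector
  equation at \<open>T\<close> yields a complete bipartite graph (\<open>positive_excess_structure\<close>).

  If \<open>e = 0\<close>, then \<open>t = 1\<close>, and other conditions are needed. An outer vertex with two neighbours is
  possible only in the path on three vertices whose end vertices form \<open>S\<close>, which is also an edge with
  one pendant vertex (\<open>outer_vertex_with_two_neighbours\<close>). If all outer vertices are pendant, then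
  they hang at a single vertex (\<open>pendants_at_one_vertex\<close>), so that every other vertex of \<open>S\<close> has no
  neighbour in \<open>T\<close> and is therefore adjacent to the whole of \<open>S\<close> (\<open>zero_excess_structure\<close>).
\<close>

section \<open>The spectral theorem for real symmetric matrices\<close>

text \<open>
  A complex eigenvalue exists by the fundamental theorem of algebra; it equals its own conjugate
  because the matrix can be moved across the Hermitian inner product.
\<close>

lemma real_symmetric_has_real_eigenvalue:
  fixes A :: "real mat"
  assumes A: "A \<in> carrier_mat n n" and sym: "A\<^sup>T = A" and "n \<noteq> 0"
  shows "\<exists>e. eigenvalue A e"
proof -
  let ?A = "map_mat complex_of_real A"
  have cA: "?A \<in> carrier_mat n n" using A by simp
  have "degree (char_poly ?A) = n" using degree_monic_char_poly[OF cA] by simp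
  then have "\<not> constant (poly (char_poly ?A))" using \<open>n \<noteq> 0\<close> by (simp add: constant_degree)
  then obtain z where z: "poly (char_poly ?A) z = 0" using fundamental_theorem_of_algebra by blast
  then have "eigenvalue ?A z" using eigenvalue_root_char_poly[OF cA] by simp
  then obtain v where v: "v \<in> carrier_vec n" "v \<noteq> 0\<^sub>v n" "?A *\<^sub>v v = z \<cdot>\<^sub>v v"
    using cA unfolding eigenvalue_def eigenvector_def by auto
  have symc: "?A\<^sup>T = ?A" using sym A
    by (metis map_mat_transpose)
  have cc: "conjugate v \<in> carrier_vec n" using v by simp
  have conjA: "?A *\<^sub>v conjugate v = conjugate (?A *\<^sub>v v)"
    using A v(1) by (intro eq_vecI) (auto simp: scalar_prod_def sum_conjugate)
  have "z * (v \<bullet>c v) = (?A *\<^sub>v v) \<bullet>c v"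
    using v cc by simp
  also have "\<dots> = (?A\<^sup>T *\<^sub>v v) \<bullet> conjugate v" by (simp add: symc)
  also have "\<dots> = v \<bullet> (?A *\<^sub>v conjugate v)"
    using transpose_vec_mult_scalar[OF cA cc v(1)] .
  also have "\<dots> = v \<bullet> (cnj z \<cdot>\<^sub>v conjugate v)"
    unfolding conjA v(3) by (simp add: conjugate_smult_vec)
  also have "\<dots> = cnj z * (v \<bullet>c v)" using v cc by simp
  finally have "z = cnj z" using conjugate_square_eq_0_vec[OF v(1)] v(2) by simp
  then obtain e where e: "z = complex_of_real e"
    by (metis Reals_cnj_iff Reals_cases)
  have "poly (map_poly complex_of_real (char_poly A)) (complex_of_real e) = 0"
    using z unfolding e of_real_hom.char_poly_hom[OF A] .
  then have "poly (char_poly A) e = 0" by simp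
  then show ?thesis using eigenvalue_root_char_poly[OF A] by blast
qed

text \<open>
  Gram--Schmidt applied to a basis starting with \<open>v\<close>, followed by normalisation of the columns.
\<close>

lemma orthogonal_mat_with_first_col:
  fixes v :: "real vec"
  assumes v: "v \<in> carrier_vec n" "v \<noteq> 0\<^sub>v n"
  shows "\<exists>W \<in> carrier_mat n n. W\<^sup>T * W = 1\<^sub>m n \<and> (\<exists>c. c \<noteq> 0 \<and> col W 0 = c \<cdot>\<^sub>v v)"
proof -
  interpret cof_vec_space n "TYPE(real)" .
  define b where "b = basis_completion v"
  define ws where "ws = gram_schmidt n b"
  from basis_completion[OF v, folded b_def]
  have dist_b: "distinct b" and indep: "\<not> lin_dep (set b)" and b: "set b \<subseteq> carrier_vec n"
    and hdb: "hd b = v" and len_b: "length b = n" by auto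
  have n: "n \<noteq> 0" using v by (metis carrier_vecD eq_vecI index_zero_vec(2) less_nat_zero_code)
  from hdb len_b n obtain vs where bv: "b = v # vs" by (cases b, auto)
  from gram_schmidt_result[OF b dist_b indep refl, folded ws_def]
  have ws: "set ws \<subseteq> carrier_vec n" "corthogonal ws" "length ws = n"
    by (auto simp: len_b)
  have hdws: "ws ! 0 = v"
    using gram_schmidt_hd[OF v(1), of vs, folded bv] ws n unfolding ws_def
    by (metis hd_conv_nth length_0_conv)
  have conj: "conjugate w = w" for w :: "real vec" by (intro eq_vecI) auto
  define N where "N i = sqrt (ws ! i \<bullet> ws ! i)" for i
  have Ni: "N i \<noteq> 0" "N i * N i = ws ! i \<bullet> ws ! i" if "i < n" for i
  proof -
    have "ws ! i \<bullet> ws ! i \<noteq> 0" using corthogonalD[OF ws(2), of i i] that ws(3) conj by simp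
    moreover have "ws ! i \<bullet> ws ! i \<ge> 0" by (simp add: scalar_prod_def sum_nonneg)
    ultimately show "N i \<noteq> 0" "N i * N i = ws ! i \<bullet> ws ! i" by (auto simp: N_def)
  qed
  define W where "W = mat n n (\<lambda>(i, j). ws ! j $ i / N j)"
  have dim: "dim_vec (ws ! i) = n" if "i < n" for i using ws that by (metis carrier_vecD nth_mem subsetD)
  have colW: "col W j = (1 / N j) \<cdot>\<^sub>v ws ! j" if "j < n" for j
    using that dim[OF that] by (intro eq_vecI) (auto simp: W_def)
  have "W\<^sup>T * W = 1\<^sub>m n"
  proof (rule eq_matI)
    fix i j assume "i < dim_row (1\<^sub>m n :: real mat)" "j < dim_col (1\<^sub>m n :: real mat)"
    then have ij: "i < n" "j < n" by auto
    have "(W\<^sup>T * W) $$ (i, j) = col W i \<bullet> col W j" using ij by (simp add: W_def)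
    also have "\<dots> = (ws ! i \<bullet> ws ! j) / (N i * N j)"
      using ij dim by (simp add: colW)
    also have "\<dots> = (if i = j then 1 else 0)"
      using Ni[OF ij(1)] Ni[OF ij(2)] corthogonalD[OF ws(2), of i j] ij ws(3) conj by auto
    finally show "(W\<^sup>T * W) $$ (i, j) = 1\<^sub>m n $$ (i, j)" using ij by simp
  qed (auto simp: W_def)
  moreover have "col W 0 = (1 / N 0) \<cdot>\<^sub>v v" using colW[of 0] n hdws by simp
  moreover have "1 / N 0 \<noteq> 0" using Ni[of 0] n by simp
  moreover have "W \<in> carrier_mat n n" by (simp add: W_def)
  ultimately show ?thesis by blast
qed

definition real_diag_mat :: "real list \<Rightarrow> real mat" where
  "real_diag_mat es = mat (length es) (length es) (\<lambda>(i, j). if i = j then es ! i else 0)"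

text \<open>
  Conjugating by an orthogonal matrix whose first column is an eigenvector clears the first column,
  hence by symmetry also the first row; the remaining block is symmetric of smaller size. The
  characteristic polynomial is carried along because the multiplicity of an eigenvalue
  in the spectrum is its multiplicity as a root.
\<close>

theorem real_symmetric_spectral_decomposition:
  fixes A :: "real mat"
  assumes "A \<in> carrier_mat n n" and "A\<^sup>T = A"
  shows "\<exists>P \<in> carrier_mat n n. \<exists>es. length es = n \<and> P\<^sup>T * P = 1\<^sub>m n \<and>
    P\<^sup>T * A * P = real_diag_mat es \<and> char_poly A = (\<Prod>e\<leftarrow>es. [:- e, 1:])"
  using assms
proof (induction n arbitrary: A)
  case 0
  then have "char_poly A = 1" using degree_monic_char_poly[of A 0] by (metis monic_degree_0)
  then show ?case using 0 by (intro bexI[of _ "1\<^sub>m 0"] exI[of _ "[]"]) (auto simp: real_diag_mat_def)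
next
  case (Suc n)
  note A = Suc.prems(1)
  obtain e v where v: "v \<in> carrier_vec (Suc n)" "v \<noteq> 0\<^sub>v (Suc n)" "A *\<^sub>v v = e \<cdot>\<^sub>v v"
    using real_symmetric_has_real_eigenvalue[OF Suc.prems] A
    unfolding eigenvalue_def eigenvector_def by auto
  obtain W c where W: "W \<in> carrier_mat (Suc n) (Suc n)" "W\<^sup>T * W = 1\<^sub>m (Suc n)"
    and c: "c \<noteq> 0" "col W 0 = c \<cdot>\<^sub>v v" using orthogonal_mat_with_first_col[OF v(1,2)] by blast
  have WT: "W\<^sup>T \<in> carrier_mat (Suc n) (Suc n)" using W by simp
  define B where "B = W\<^sup>T * A * W"
  have B: "B \<in> carrier_mat (Suc n) (Suc n)" using W A by (simp add: B_def)
  have BT: "B\<^sup>T = B"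
    unfolding B_def using W A Suc.prems(2)
    by (simp add: transpose_mult[of _ "Suc n" "Suc n" _ "Suc n"] assoc_mult_mat[of _ "Suc n" "Suc n" _ "Suc n" _ "Suc n"])
  have colB: "col B 0 = e \<cdot>\<^sub>v unit_vec (Suc n) 0"
  proof -
    have "A *\<^sub>v col W 0 = e \<cdot>\<^sub>v col W 0" unfolding c(2) using A v
      by (simp add: mult_mat_vec smult_smult_assoc mult.commute)
    moreover have "col B 0 = W\<^sup>T *\<^sub>v (A *\<^sub>v col W 0)"
      unfolding B_def
      using W(1) A WT col_mult2[of "W\<^sup>T" "Suc n" "Suc n" "A * W" "Suc n" 0] col_mult2[OF A W(1), of 0]
      by (simp add: assoc_mult_mat[of _ "Suc n" "Suc n" _ "Suc n" _ "Suc n"] del: col_mult2)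
    ultimately have "col B 0 = e \<cdot>\<^sub>v (W\<^sup>T *\<^sub>v col W 0)"
      using W(1) mult_mat_vec[OF WT, of "col W 0" e] col_carrier_vec[OF _ W(1), of 0] by simp
    also have "W\<^sup>T *\<^sub>v col W 0 = col (1\<^sub>m (Suc n)) 0"
      using W(1) col_mult2[OF WT W(1), of 0] unfolding W(2) by simp
    finally show ?thesis by simp
  qed
  define B' where "B' = mat n n (\<lambda>(i, j). B $$ (Suc i, Suc j))"
  let ?e = "mat 1 1 (\<lambda>_. e)"
  have Bblock: "B = four_block_mat ?e (0\<^sub>m 1 n) (0\<^sub>m n 1) B'"
  proof (rule eq_matI)
    fix i j assume "i < dim_row (four_block_mat ?e (0\<^sub>m 1 n) (0\<^sub>m n 1) B')"
      "j < dim_col (four_block_mat ?e (0\<^sub>m 1 n) (0\<^sub>m n 1) B')"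
    then have ij: "i < Suc n" "j < Suc n" by (auto simp: B'_def)
    have c0: "B $$ (k, 0) = (if k = 0 then e else 0)" if "k < Suc n" for k
      using arg_cong[OF colB, of "\<lambda>x. x $ k"] that B by (auto simp: unit_vec_def)
    have r0: "B $$ (0, k) = (if k = 0 then e else 0)" if "k < Suc n" for k
      using c0[OF that] arg_cong[OF BT, of "\<lambda>M. M $$ (k, 0)"] that B by auto
    show "B $$ (i, j) = four_block_mat ?e (0\<^sub>m 1 n) (0\<^sub>m n 1) B' $$ (i, j)"
      using ij c0[of i] r0[of j] by (cases i; cases j) (auto simp: B'_def)
  qed (use B in \<open>auto simp: B'_def\<close>)
  have B': "B' \<in> carrier_mat n n" by (simp add: B'_def)
  have B'T: "B'\<^sup>T = B'"
  proof (rule eq_matI)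
    fix i j assume "i < dim_row B'" "j < dim_col B'"
    then have "i < n" "j < n" by (auto simp: B'_def)
    then show "B'\<^sup>T $$ (i, j) = B' $$ (i, j)"
      using arg_cong[OF BT, of "\<lambda>M. M $$ (Suc i, Suc j)"] B by (auto simp: B'_def)
  qed (auto simp: B'_def)
  from Suc.IH[OF B' B'T] obtain P es where P: "P \<in> carrier_mat n n" "P\<^sup>T * P = 1\<^sub>m n"
    and es: "length es = n" "P\<^sup>T * B' * P = real_diag_mat es" "char_poly B' = (\<Prod>e\<leftarrow>es. [:- e, 1:])"
    by blast
  define Q where "Q = four_block_mat (1\<^sub>m 1) (0\<^sub>m 1 n) (0\<^sub>m n 1) P"
  have Q: "Q \<in> carrier_mat (Suc n) (Suc n)" using four_block_carrier_mat[of "1\<^sub>m 1" 1 1 P n n] P by (simp add: Q_def)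
  have QT: "Q\<^sup>T = four_block_mat (1\<^sub>m 1) (0\<^sub>m 1 n) (0\<^sub>m n 1) P\<^sup>T"
    unfolding Q_def by (subst transpose_four_block_mat) (use P in auto)
  have PT: "P\<^sup>T \<in> carrier_mat n n" using P by simp
  have block: "four_block_mat a (0\<^sub>m 1 n) (0\<^sub>m n 1) M * four_block_mat b (0\<^sub>m 1 n) (0\<^sub>m n 1) N =
      four_block_mat (a * b) (0\<^sub>m 1 n) (0\<^sub>m n 1) (M * N)"
    if "a \<in> carrier_mat 1 1" "b \<in> carrier_mat 1 1" "M \<in> carrier_mat n n" "N \<in> carrier_mat n n"
    for a b M N :: "real mat"
    by (subst mult_four_block_mat[of _ 1 1 _ n _ n _ _ 1 _ n]) (use that in auto)
  have QQ: "Q\<^sup>T * Q = 1\<^sub>m (Suc n)"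
    unfolding QT unfolding Q_def block[OF one_carrier_mat one_carrier_mat PT P(1)] P(2)
    using four_block_one_mat[of 1 n] by simp
  have e_carrier: "?e \<in> carrier_mat 1 1" by simp
  have QBQ: "Q\<^sup>T * B * Q = real_diag_mat (e # es)"
  proof -
    have "Q\<^sup>T * B * Q = four_block_mat ?e (0\<^sub>m 1 n) (0\<^sub>m n 1) (P\<^sup>T * B' * P)"
      unfolding QT Bblock unfolding Q_def block[OF one_carrier_mat e_carrier PT B']
        block[OF mult_carrier_mat[OF one_carrier_mat e_carrier] one_carrier_mat mult_carrier_mat[OF PT B'] P(1)]
      using left_mult_one_mat[OF e_carrier] right_mult_one_mat[OF e_carrier] by simp
    also have "\<dots> = real_diag_mat (e # es)"
      unfolding es(2) by (rule eq_matI) (use es(1) in \<open>auto simp: real_diag_mat_def nth_Cons'\<close>)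
    finally show ?thesis .
  qed
  have QTc: "Q\<^sup>T \<in> carrier_mat (Suc n) (Suc n)" using Q by simp
  have WQ: "W * Q \<in> carrier_mat (Suc n) (Suc n)" using W Q by simp
  note am = assoc_mult_mat[of _ "Suc n" "Suc n" _ "Suc n" _ "Suc n"]
  have T: "(W * Q)\<^sup>T = Q\<^sup>T * W\<^sup>T" using transpose_mult[OF W(1) Q] .
  have "(W * Q)\<^sup>T * (W * Q) = Q\<^sup>T * (W\<^sup>T * W) * Q"
    unfolding T using W(1) WT Q QTc by (simp add: am)
  then have o: "(W * Q)\<^sup>T * (W * Q) = 1\<^sub>m (Suc n)" unfolding W(2) using QQ Q by simp
  have "(W * Q)\<^sup>T * A * (W * Q) = Q\<^sup>T * B * Q"
    unfolding T B_def using W(1) WT Q QTc A by (simp add: am)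
  then have d: "(W * Q)\<^sup>T * A * (W * Q) = real_diag_mat (e # es)" using QBQ by simp
  have WW: "W * W\<^sup>T = 1\<^sub>m (Suc n)"
    using mat_mult_left_right_inverse[OF WT W(1) W(2)] .
  have "A = W * W\<^sup>T * A * (W * W\<^sup>T)" unfolding WW using A by simp
  then have "A = W * B * W\<^sup>T" unfolding B_def using W(1) WT A by (simp add: am)
  then have "similar_mat_wit A B W W\<^sup>T"
    by (intro similar_mat_witI[OF WW W(2) _ A B W(1) WT])
  then have "char_poly A = char_poly B"
    by (intro char_poly_similar) (auto simp: similar_mat_def)
  also have "\<dots> = char_poly ?e * char_poly B'"
    unfolding Bblock by (rule char_poly_four_block_zeros_col) (use B' in auto)
  also have "char_poly ?e = [:- e, 1:]" by (simp add: char_poly_defs det_def sign_def)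
  finally have "char_poly A = (\<Prod>e\<leftarrow>e # es. [:- e, 1:])" using es(3) by simp
  then show ?case using WQ o d es(1) by (intro bexI[of _ "W * Q"] exI[of _ "e # es"]) auto
qed

lemma nontrivial_common_zero:
  fixes rs :: "'a :: field vec list"
  assumes rs: "set rs \<subseteq> carrier_vec n" and len: "length rs < n"
  shows "\<exists>x \<in> carrier_vec n. x \<noteq> 0\<^sub>v n \<and> (\<forall>r \<in> set rs. r \<bullet> x = 0)"
proof -
  define c where "c i = (if i < length rs then rs ! i else 0\<^sub>v n)" for i
  have c: "c \<in> {0..<n} \<rightarrow> carrier_vec n" 
    unfolding c_def using subsetD[OF rs nth_mem] by simp
  let ?M = "mat\<^sub>r n n (\<lambda>i. if i = n - 1 then 0\<^sub>v n else c i)"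
  have "det ?M = 0" using det_row_0[OF _ c, of "n - 1"] len by simp
  then obtain x where x: "x \<in> carrier_vec n" "x \<noteq> 0\<^sub>v n" "?M *\<^sub>v x = 0\<^sub>v n"
    using det_0_iff_vec_prod_zero_field[of ?M n] by auto
  have "r \<bullet> x = 0" if "r \<in> set rs" for r
  proof -
    obtain i where i: "i < length rs" "r = rs ! i" using \<open>r \<in> set rs\<close> by (metis in_set_conv_nth)
    have r: "r \<in> carrier_vec n" using rs \<open>r \<in> set rs\<close> by blast
    show ?thesis
    proof (cases "i = n - 1")
      case True
      then show ?thesis using i len by simp
    next
      case False
      then have "row ?M i = r"
        using i len r by (subst row_mat_of_row_fun) (auto simp: c_def)
      moreover have "row ?M i \<bullet> x = (?M *\<^sub>v x) $ i"
        by (rule index_mult_mat_vec[symmetric]) (use i len in simp)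
      ultimately show ?thesis unfolding x(3) using i len by (metis index_zero_vec(1) order.strict_trans)
    qed
  qed
  then show ?thesis using x by blast
qed

text \<open>
  This turns a bound on the \<open>i\<close>-th largest entry into a bound on the number of eigenvectors that a
  test vector has to avoid.
\<close>

lemma size_filter_greater_nth_largest:
  fixes M :: "'a :: linorder multiset"
  assumes "1 \<le> i" "i \<le> size M" "nth_largest M i \<le> t"
  shows "size (filter_mset (\<lambda>e. t < e) M) < i"
proof -
  define xs where "xs = sorted_list_of_multiset M"
  define ys where "ys = rev xs"
  have M: "mset ys = M" "length ys = size M"
    by (simp_all add: ys_def xs_def) (metis mset_sorted_list_of_multiset size_mset)
  have anti: "ys ! j \<ge> ys ! k" if "j \<le> k" "k < length ys" for j k
    using that sorted_rev_nth_mono[of ys] by (simp add: ys_def xs_def)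
  have "{j. j < length ys \<and> t < ys ! j} \<subseteq> {..<i - 1}"
  proof
    fix j assume j: "j \<in> {j. j < length ys \<and> t < ys ! j}"
    have "ys ! (i - 1) \<le> t" using assms(3) by (simp add: nth_largest_def ys_def xs_def)
    then show "j \<in> {..<i - 1}" using anti[of "i - 1" j] j by fastforce
  qed
  then have "card {j. j < length ys \<and> t < ys ! j} \<le> i - 1"
    by (metis card_lessThan card_mono finite_lessThan)
  then have "length (filter (\<lambda>e. t < e) ys) < i"
    using assms(1) by (simp add: length_filter_conv_card)
  then show ?thesis using M(1) by (metis mset_filter size_mset)
qed

text \<open>
  The equality case of the Courant--Fischer principle. Fewer than \<open>m\<close> eigenvalues exceed \<open>t\<close>, so
  there is a nonzero \<open>x\<close> orthogonal to their eigenvectors and to all of \<open>rs\<close>. In the eigenbasis, the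
  difference between the two sides of the inequality is a sum of nonnegative terms, one for each
  remaining eigenvector; if it vanishes, only eigenvectors for \<open>t\<close> contribute to \<open>x\<close>.
\<close>

theorem eigenvector_or_small_form_on_subspace:
  fixes A :: "real mat"
  assumes A: "A \<in> carrier_mat n n" "A\<^sup>T = A"
    and m: "1 \<le> m" "m \<le> n" and le: "nth_largest (proots (char_poly A)) m \<le> t"
    and rs: "set rs \<subseteq> carrier_vec n" "length rs + m \<le> n"
  shows "\<exists>x \<in> carrier_vec n. x \<noteq> 0\<^sub>v n \<and> (\<forall>r \<in> set rs. r \<bullet> x = 0) \<and>
    x \<bullet> (A *\<^sub>v x) \<le> t * (x \<bullet> x) \<and> (x \<bullet> (A *\<^sub>v x) = t * (x \<bullet> x) \<longrightarrow> A *\<^sub>v x = t \<cdot>\<^sub>v x)"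
proof -
  from real_symmetric_spectral_decomposition[OF A] obtain P es where
    P: "P \<in> carrier_mat n n" "P\<^sup>T * P = 1\<^sub>m n" and es: "length es = n" "P\<^sup>T * A * P = real_diag_mat es"
    and cp: "char_poly A = (\<Prod>e\<leftarrow>es. [:- e, 1:])" by blast
  have "proots (\<Prod>e\<leftarrow>xs. [:- e, 1:]) = mset xs" for xs :: "real list"
  proof (induction xs)
    case (Cons e xs)
    have "proots ([:- e, 1:] * (\<Prod>e\<leftarrow>xs. [:- e, 1:])) = {#e#} + mset xs"
      by (subst proots_mult) (auto simp: Cons.IH prod_list_zero_iff)
    then show ?case by simp
  qed simp
  then have pr: "proots (char_poly A) = mset es" by (simp add: cp)
  have PT: "P\<^sup>T \<in> carrier_mat n n" using P by simp
  have PP: "P * P\<^sup>T = 1\<^sub>m n" using mat_mult_left_right_inverse[OF PT P(1) P(2)] .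
  \<comment> \<open>the eigenvectors whose eigenvalues exceed \<open>t\<close>\<close>
  define ps where "ps = map (col P) (filter (\<lambda>i. t < es ! i) [0..<n])"
  have "length ps = size (filter_mset (\<lambda>e. t < e) (mset es))"
    unfolding ps_def by (simp add: length_filter_conv_card es(1) flip: mset_filter cong: conj_cong)
  also have "\<dots> < m" using size_filter_greater_nth_largest[of m "mset es" t] m le es(1) pr by simp
  finally have "length (rs @ ps) < n" using rs(2) by simp
  moreover have "set (rs @ ps) \<subseteq> carrier_vec n" using rs(1) P(1) by (auto simp: ps_def)
  ultimately obtain x where x: "x \<in> carrier_vec n" "x \<noteq> 0\<^sub>v n" "\<forall>r \<in> set (rs @ ps). r \<bullet> x = 0"
    using nontrivial_common_zero by blast
  define y where "y = P\<^sup>T *\<^sub>v x"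
  have y: "y \<in> carrier_vec n" using PT x by (simp add: y_def)
  have xy: "x = P *\<^sub>v y" unfolding y_def
    using assoc_mult_mat_vec[OF P(1) PT x(1)] x(1) PP by simp
  have y0: "y $ i = 0" if "i < n" "t < es ! i" for i
  proof -
    have "y $ i = col P i \<bullet> x" using that P by (simp add: y_def)
    then show ?thesis using x(3) that by (auto simp: ps_def)
  qed
  have D: "real_diag_mat es \<in> carrier_mat n n" by (simp add: real_diag_mat_def es(1))
  have Dy: "(real_diag_mat es *\<^sub>v y) $ i = es ! i * y $ i" if "i < n" for i
    using that y by (simp add: real_diag_mat_def es(1) scalar_prod_def if_distrib[of "\<lambda>a. a * _"] cong: if_cong)
  have PTx: "P\<^sup>T *\<^sub>v (A *\<^sub>v x) = real_diag_mat es *\<^sub>v y"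
    unfolding es(2)[symmetric] using xy P(1) PT A(1) y
    by (simp add: assoc_mult_mat_vec[of _ n n _ n])
  have Ax: "A *\<^sub>v x \<in> carrier_vec n" using A x by simp
  have AxP: "A *\<^sub>v x = P *\<^sub>v (real_diag_mat es *\<^sub>v y)"
    unfolding PTx[symmetric] using assoc_mult_mat_vec[OF P(1) PT Ax] PP Ax by simp
  have iso: "(P *\<^sub>v a) \<bullet> b = a \<bullet> (P\<^sup>T *\<^sub>v b)" if "a \<in> carrier_vec n" "b \<in> carrier_vec n" for a b
    using transpose_vec_mult_scalar[OF PT that(2,1)] by simp
  have "x \<bullet> (A *\<^sub>v x) = y \<bullet> (real_diag_mat es *\<^sub>v y)"
    using iso[OF y Ax] xy PTx by simp
  also have "\<dots> = (\<Sum>i<n. es ! i * (y $ i)\<^sup>2)"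
    using D y Dy by (auto simp: scalar_prod_def lessThan_atLeast0 power2_eq_square algebra_simps intro!: sum.cong)
  finally have form: "x \<bullet> (A *\<^sub>v x) = (\<Sum>i<n. es ! i * (y $ i)\<^sup>2)" .
  have "x \<bullet> x = y \<bullet> y" using iso[OF y x(1)] unfolding xy[symmetric] y_def[symmetric] .
  also have "\<dots> = (\<Sum>i<n. (y $ i)\<^sup>2)" using y by (simp add: scalar_prod_def lessThan_atLeast0 power2_eq_square)
  finally have norm: "x \<bullet> x = (\<Sum>i<n. (y $ i)\<^sup>2)" .
  have diff: "t * (x \<bullet> x) - x \<bullet> (A *\<^sub>v x) = (\<Sum>i<n. (t - es ! i) * (y $ i)\<^sup>2)"
    by (simp add: form norm sum_distrib_left sum_subtractf left_diff_distrib)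
  have nonneg: "(t - es ! i) * (y $ i)\<^sup>2 \<ge> 0" if "i < n" for i
    using y0[OF that] by (cases "t < es ! i") auto
  have "x \<bullet> (A *\<^sub>v x) \<le> t * (x \<bullet> x)"
    using diff sum_nonneg[of "{..<n}" "\<lambda>i. (t - es ! i) * (y $ i)\<^sup>2"] nonneg by simp
  moreover have "A *\<^sub>v x = t \<cdot>\<^sub>v x" if "x \<bullet> (A *\<^sub>v x) = t * (x \<bullet> x)"
  proof -
    have "(\<Sum>i<n. (t - es ! i) * (y $ i)\<^sup>2) = 0" using that diff by simp
    then have "(t - es ! i) * (y $ i)\<^sup>2 = 0" if "i < n" for i
      using that nonneg sum_nonneg_eq_0_iff[of "{..<n}" "\<lambda>i. (t - es ! i) * (y $ i)\<^sup>2"] by simp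
    then have "real_diag_mat es *\<^sub>v y = t \<cdot>\<^sub>v y"
      using D y Dy by (intro eq_vecI) auto
    then show ?thesis unfolding AxP using mult_mat_vec[OF P(1) y] xy by simp
  qed
  ultimately show ?thesis using x by auto
qed

section \<open>The Laplacian as a quadratic form\<close>

text \<open>
  Functions on the vertices replace vectors indexed by an enumeration of the vertices:
  \<open>graph_laplacian G x\<close> is the function given by the matrix-vector product, and \<open>graph_energy G x\<close> is the
  value of the quadratic form of the Laplacian matrix at \<open>x\<close>.
\<close>

definition graph_laplacian :: "'a pair_pre_digraph \<Rightarrow> ('a \<Rightarrow> real) \<Rightarrow> 'a \<Rightarrow> real" where
  "graph_laplacian G x v = (\<Sum>w | (v, w) \<in> parcs G. x v - x w)"

definition graph_energy :: "'a pair_pre_digraph \<Rightarrow> ('a \<Rightarrow> real) \<Rightarrow> real" where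
  "graph_energy G x = (\<Sum>v\<in>pverts G. x v * graph_laplacian G x v)"

context pair_graph
begin

lemma out_degree_eq_card_neighbours: "out_degree (with_proj G) v = card {w. (v, w) \<in> parcs G}"
proof -
  have "out_arcs (with_proj G) v = Pair v ` {w. (v, w) \<in> parcs G}"
    by (auto simp: out_arcs_def)
  then show ?thesis by (simp add: out_degree_def card_image inj_on_def)
qed

lemma sum_neighbours:
  "(\<Sum>w | (v, w) \<in> parcs G. f w) = (\<Sum>w\<in>pverts G. of_bool ((v, w) \<in> parcs G) * (f w :: real))"
proof -
  have "(\<Sum>w | (v, w) \<in> parcs G. f w) = (\<Sum>w\<in>pverts G \<inter> {w. (v, w) \<in> parcs G}. f w)"
    using in_arcsD2 by (intro sum.cong refl) blast
  also have "\<dots> = (\<Sum>w\<in>pverts G. of_bool ((v, w) \<in> parcs G) * f w)"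
    using sum.inter_restrict[OF pair_finite_verts, of f "{w. (v, w) \<in> parcs G}"]
    by (auto intro!: sum.cong)
  finally show ?thesis .
qed

lemma laplacian_mat_mult_vec:
  assumes vs: "distinct vs" "set vs = pverts G" and i: "i < length vs"
  shows "(laplacian_mat G vs *\<^sub>v vec (length vs) (\<lambda>i. x (vs ! i))) $ i = graph_laplacian G x (vs ! i)"
proof -
  have bij: "bij_betw ((!) vs) {..<length vs} (pverts G)" using bij_betw_nth[OF vs(1)] vs(2) by auto
  have "(laplacian_mat G vs *\<^sub>v vec (length vs) (\<lambda>i. x (vs ! i))) $ i =
      (\<Sum>j<length vs. ((if i = j then real (out_degree (with_proj G) (vs ! i)) else 0)
        - (if (vs ! i, vs ! j) \<in> parcs G then 1 else 0)) * x (vs ! j))"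
    using i by (auto simp: laplacian_mat_def degree_mat_def adjacency_mat_def scalar_prod_def
        lessThan_atLeast0 intro!: sum.cong)
  also have "\<dots> = real (out_degree (with_proj G) (vs ! i)) * x (vs ! i)
      - (\<Sum>j<length vs. of_bool ((vs ! i, vs ! j) \<in> parcs G) * x (vs ! j))"
    using i by (simp add: left_diff_distrib sum_subtractf if_distrib[of "\<lambda>a. a * _"] of_bool_def cong: if_cong)
  also have "(\<Sum>j<length vs. of_bool ((vs ! i, vs ! j) \<in> parcs G) * x (vs ! j)) =
      (\<Sum>w\<in>pverts G. of_bool ((vs ! i, w) \<in> parcs G) * x w)"
    by (rule sum.reindex_bij_betw[OF bij])
  also have "\<dots> = (\<Sum>w | (vs ! i, w) \<in> parcs G. x w)" by (rule sum_neighbours[symmetric])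
  finally show ?thesis
    by (simp add: graph_laplacian_def sum_subtractf out_degree_eq_card_neighbours)
qed

lemma laplacian_mat_symmetric: "(laplacian_mat G vs)\<^sup>T = laplacian_mat G vs"
  by (rule eq_matI) (auto simp: laplacian_mat_def degree_mat_def adjacency_mat_def arcs_symmetric)

text \<open>
  The Courant--Fischer principle in terms of functions on the vertices; \<open>C i\<close> holds the coefficients of the
  linear condition with index \<open>i\<close>.
\<close>

theorem laplacian_test_function:
  fixes C :: "'b \<Rightarrow> 'a \<Rightarrow> real"
  assumes m: "1 \<le> m" and le: "laplacian_eigenvalue G m \<le> t"
    and I: "finite I" "card I + m \<le> card (pverts G)"
  shows "\<exists>x. (\<exists>v\<in>pverts G. x v \<noteq> 0) \<and> (\<forall>i\<in>I. (\<Sum>v\<in>pverts G. C i v * x v) = 0) \<and>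
    graph_energy G x \<le> t * (\<Sum>v\<in>pverts G. (x v)\<^sup>2) \<and>
    (graph_energy G x = t * (\<Sum>v\<in>pverts G. (x v)\<^sup>2) \<longrightarrow>
      (\<forall>v\<in>pverts G. graph_laplacian G x v = t * x v))"
proof -
  define vs where "vs = (SOME vs. distinct vs \<and> set vs = pverts G)"
  have "\<exists>vs. distinct vs \<and> set vs = pverts G" using finite_distinct_list[OF pair_finite_verts] by blast
  then have vs: "distinct vs" "set vs = pverts G"
    using someI_ex[of "\<lambda>vs. distinct vs \<and> set vs = pverts G"] by (auto simp: vs_def)
  define n where "n = length vs"
  have n: "n = card (pverts G)" using vs by (metis distinct_card n_def)
  have bij: "bij_betw ((!) vs) {..<n} (pverts G)" using bij_betw_nth[OF vs(1)] vs(2) n_def by auto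
  have sumV: "(\<Sum>v\<in>pverts G. f v) = (\<Sum>i<n. f (vs ! i))" for f :: "'a \<Rightarrow> real"
    using sum.reindex_bij_betw[OF bij, of f] by simp
  let ?L = "laplacian_mat G vs"
  have L: "?L \<in> carrier_mat n n"
    by (rule carrier_matI) (simp_all add: laplacian_mat_def degree_mat_def adjacency_mat_def n_def)
  obtain js where js: "distinct js" "set js = I" using finite_distinct_list[OF I(1)] by blast
  define rs where "rs = map (\<lambda>i. vec n (\<lambda>k. C i (vs ! k))) js"
  have rs: "set rs \<subseteq> carrier_vec n" "length rs + m \<le> n"
    using I(2) js distinct_card[OF js(1)] n by (auto simp: rs_def)
  have le': "nth_largest (proots (char_poly ?L)) m \<le> t"
    using le by (simp add: laplacian_eigenvalue_def laplacian_spectrum_def vs_def)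
  from eigenvector_or_small_form_on_subspace[OF L laplacian_mat_symmetric m _ le' rs] rs(2)
  obtain y where y: "y \<in> carrier_vec n" "y \<noteq> 0\<^sub>v n" "\<forall>r\<in>set rs. r \<bullet> y = 0"
      "y \<bullet> (?L *\<^sub>v y) \<le> t * (y \<bullet> y)" "y \<bullet> (?L *\<^sub>v y) = t * (y \<bullet> y) \<longrightarrow> ?L *\<^sub>v y = t \<cdot>\<^sub>v y"
    by auto
  define x where "x v = y $ (the_inv_into {..<n} ((!) vs) v)" for v
  have xi: "x (vs ! i) = y $ i" if "i < n" for i
    using that bij by (simp add: x_def bij_betw_def the_inv_into_f_f)
  have yx: "y = vec (length vs) (\<lambda>i. x (vs ! i))"
    using y(1) xi by (intro eq_vecI) (auto simp: n_def)
  have Ly: "(?L *\<^sub>v y) $ i = graph_laplacian G x (vs ! i)" if "i < n" for i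
    unfolding yx using laplacian_mat_mult_vec[OF vs] that by (simp add: n_def)
  have dimL: "dim_vec (?L *\<^sub>v y) = n" using L by simp
  have en: "y \<bullet> (?L *\<^sub>v y) = graph_energy G x"
    unfolding graph_energy_def sumV scalar_prod_def dimL
    using Ly xi by (auto simp: lessThan_atLeast0 intro!: sum.cong)
  have nrm: "y \<bullet> y = (\<Sum>v\<in>pverts G. (x v)\<^sup>2)"
    unfolding sumV scalar_prod_def using y(1) xi by (auto simp: lessThan_atLeast0 power2_eq_square intro!: sum.cong)
  have "\<exists>i<n. y $ i \<noteq> 0"
  proof (rule ccontr)
    assume "\<not> ?thesis"
    then have "y = 0\<^sub>v n" using y(1) by (intro eq_vecI) auto
    then show False using y(2) by blast
  qed
  then have "\<exists>v\<in>pverts G. x v \<noteq> 0" using xi vs(2) n_def by (metis nth_mem)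
  moreover have "(\<Sum>v\<in>pverts G. C i v * x v) = 0" if "i \<in> I" for i
  proof -
    have "vec n (\<lambda>k. C i (vs ! k)) \<bullet> y = 0" using y(3) that js(2) by (auto simp: rs_def)
    then show ?thesis unfolding sumV scalar_prod_def using y(1) xi by (auto simp: lessThan_atLeast0)
  qed
  moreover have "graph_laplacian G x v = t * x v"
    if tight: "graph_energy G x = t * (\<Sum>v\<in>pverts G. (x v)\<^sup>2)" and v: "v \<in> pverts G" for v
  proof -
    have "?L *\<^sub>v y = t \<cdot>\<^sub>v y" using y(5) tight en nrm by simp
    moreover obtain i where "i < n" "v = vs ! i" using v vs(2) n_def by (metis in_set_conv_nth)
    ultimately show ?thesis using Ly[of i] xi[of i] y(1) by simp
  qed
  ultimately show ?thesis using y(4) en nrm by (intro exI[of _ x]) auto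
qed

lemma graph_energy_eq_sum_squares:
  "graph_energy G x = (\<Sum>v\<in>pverts G. \<Sum>w\<in>pverts G. of_bool ((v, w) \<in> parcs G) * (x v - x w)\<^sup>2) / 2"
proof -
  let ?V = "pverts G" and ?a = "\<lambda>v w. of_bool ((v, w) \<in> parcs G) :: real"
  have sym: "?a v w = ?a w v" for v w by (auto simp: arcs_symmetric)
  have 1: "graph_energy G x = (\<Sum>v\<in>?V. \<Sum>w\<in>?V. ?a v w * (x v * (x v - x w)))"
    unfolding graph_energy_def graph_laplacian_def sum_neighbours
    by (simp add: sum_distrib_left algebra_simps)
  have "graph_energy G x = (\<Sum>v\<in>?V. \<Sum>w\<in>?V. ?a w v * (x w * (x w - x v)))"
    unfolding 1 by (rule sum.swap)
  then have "2 * graph_energy G x =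
      (\<Sum>v\<in>?V. \<Sum>w\<in>?V. ?a v w * (x v * (x v - x w)) + ?a w v * (x w * (x w - x v)))"
    using 1 by (simp add: sum.distrib)
  also have "\<dots> = (\<Sum>v\<in>?V. \<Sum>w\<in>?V. ?a v w * (x v - x w)\<^sup>2)"
  proof (intro sum.cong refl)
    fix v w
    show "?a v w * (x v * (x v - x w)) + ?a w v * (x w * (x w - x v)) = ?a v w * (x v - x w)\<^sup>2"
      unfolding sym[of w v] by (simp add: power2_eq_square algebra_simps)
  qed
  finally show ?thesis by simp
qed

end

section \<open>Graphs with a vertex cover of large outer degrees\<close>

text \<open>
  Every vertex of \<open>S\<close> may carry its own number of pendant vertices.
\<close>

definition clique_with_pendants :: "'a pair_pre_digraph \<Rightarrow> 'a set \<Rightarrow> bool" where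
  "clique_with_pendants G S \<longleftrightarrow> S \<subseteq> pverts G \<and>
    (\<forall>u\<in>S. \<forall>w\<in>S. u \<noteq> w \<longrightarrow> (u, w) \<in> parcs G) \<and>
    (\<forall>v\<in>pverts G - S. \<exists>u\<in>S. {w. (v, w) \<in> parcs G} = {u})"

text \<open>
  What a nexus \<open>S\<close> provides, with the degrees eliminated: a vertex \<open>u\<close> of degree at least \<open>d\<close> that misses \<open>c\<close>
  of the other vertices of \<open>S\<close> has \<open>card S - 1 - c\<close> neighbours in \<open>S\<close>, hence at least
  \<open>(d - card S + 1) + c\<close> neighbours outside. The number \<open>e\<close> plays the part of \<open>d - card S + 1\<close>.
\<close>

locale covered_graph = pair_graph G for G :: "'a pair_pre_digraph" +
  fixes S :: "'a set" and e :: nat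
  assumes S_subset: "S \<subseteq> pverts G"
    and cover: "(u, v) \<in> parcs G \<Longrightarrow> u \<in> S \<or> v \<in> S"
    and no_isolated: "v \<in> pverts G \<Longrightarrow> \<exists>w. (v, w) \<in> parcs G"
    and excess: "u \<in> S \<Longrightarrow>
      e + card {w \<in> S - {u}. (u, w) \<notin> parcs G} \<le> card {v \<in> pverts G - S. (u, v) \<in> parcs G}"
begin

abbreviation T :: "'a set" where "T \<equiv> pverts G - S"

abbreviation outer :: "'a \<Rightarrow> 'a set" where "outer u \<equiv> {v \<in> T. (u, v) \<in> parcs G}"

abbreviation conn :: "'a \<Rightarrow> 'a \<Rightarrow> real" where "conn u w \<equiv> of_bool ((u, w) \<in> parcs G)"

abbreviation codeg :: "'a \<Rightarrow> nat" where "codeg u \<equiv> card {w \<in> S - {u}. (u, w) \<notin> parcs G}"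

definition pair_sum :: "('a \<Rightarrow> 'a \<Rightarrow> real) \<Rightarrow> real" where
  "pair_sum f = (\<Sum>u\<in>S. \<Sum>w\<in>S - {u}. f u w)"

lemma finite_S: "finite S" using S_subset pair_finite_verts finite_subset by blast

lemma finite_T: "finite T" using pair_finite_verts by blast

lemma conn_sym: "conn u w = conn w u" by (auto simp: arcs_symmetric)

lemma T_neighbours: "v \<in> T \<Longrightarrow> (v, w) \<in> parcs G \<Longrightarrow> w \<in> S" using cover by blast

lemma sum_vertices: "(\<Sum>v\<in>pverts G. f v) = (\<Sum>v\<in>S. f v) + (\<Sum>v\<in>T. f v :: real)"
  using S_subset pair_finite_verts by (metis sum.subset_diff add.commute)

lemma pair_sum_swap: "pair_sum f = pair_sum (\<lambda>u w. f w u)"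
proof -
  have "pair_sum f = (\<Sum>u\<in>S. \<Sum>w\<in>S. if u \<noteq> w then f u w else 0)"
    unfolding pair_sum_def
    by (intro sum.cong refl sum.mono_neutral_cong_left) (auto simp: finite_S)
  also have "\<dots> = (\<Sum>w\<in>S. \<Sum>u\<in>S. if u \<noteq> w then f u w else 0)" by (rule sum.swap)
  also have "\<dots> = pair_sum (\<lambda>u w. f w u)"
    unfolding pair_sum_def
    by (intro sum.cong refl sum.mono_neutral_cong_right) (auto simp: finite_S)
  finally show ?thesis .
qed

lemma pair_sum_cong:
  "(\<And>u w. u \<in> S \<Longrightarrow> w \<in> S \<Longrightarrow> u \<noteq> w \<Longrightarrow> f u w = g u w) \<Longrightarrow> pair_sum f = pair_sum g"
  unfolding pair_sum_def by (intro sum.cong) auto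

lemma pair_sum_add: "pair_sum (\<lambda>u w. f u w + g u w) = pair_sum f + pair_sum g"
  by (simp add: pair_sum_def sum.distrib)

lemma pair_sum_mult: "pair_sum (\<lambda>u w. c * f u w) = c * pair_sum f"
  by (simp add: pair_sum_def sum_distrib_left)

lemma pair_sum_nonneg:
  "(\<And>u w. u \<in> S \<Longrightarrow> w \<in> S \<Longrightarrow> u \<noteq> w \<Longrightarrow> f u w \<ge> 0) \<Longrightarrow> pair_sum f \<ge> 0"
  unfolding pair_sum_def by (intro sum_nonneg) auto

lemma pair_sum_eq_0D:
  assumes "\<And>u w. u \<in> S \<Longrightarrow> w \<in> S \<Longrightarrow> u \<noteq> w \<Longrightarrow> f u w \<ge> 0" "pair_sum f = 0"
    and "u \<in> S" "w \<in> S" "u \<noteq> w"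
  shows "f u w = 0"
proof -
  have "\<forall>u\<in>S. (\<Sum>w\<in>S - {u}. f u w) = 0"
    using assms(1,2) finite_S unfolding pair_sum_def by (subst sum_nonneg_eq_0_iff[symmetric]) (auto intro: sum_nonneg)
  then have "\<forall>w\<in>S - {u}. f u w = 0"
    using assms(1,3) finite_S by (subst sum_nonneg_eq_0_iff[symmetric]) auto
  then show ?thesis using assms by auto
qed

text \<open>
  The energy surplus is compared with sums over ordered pairs of distinct vertices of \<open>S\<close>. This lemma and the next
  convert between sums over single vertices and pair sums, so that the whole surplus can be estimated
  pair by pair.
\<close>

lemma pair_sum_fst: "pair_sum (\<lambda>u w. f u) = (real (card S) - 1) * (\<Sum>u\<in>S. f u)"
proof -
  have "pair_sum (\<lambda>u w. f u) = (\<Sum>u\<in>S. (real (card S) - 1) * f u)"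
    unfolding pair_sum_def
  proof (intro sum.cong refl)
    fix u assume "u \<in> S"
    then have "card S \<ge> 1" "card (S - {u}) = card S - 1"
      using finite_S by (auto simp: Suc_le_eq card_gt_0_iff)
    then show "(\<Sum>w\<in>S - {u}. f u) = (real (card S) - 1) * f u" by (simp add: of_nat_diff)
  qed
  then show ?thesis by (simp add: sum_distrib_left)
qed

lemma pair_sum_prod: "pair_sum (\<lambda>u w. f u * g w) = (\<Sum>u\<in>S. f u) * (\<Sum>u\<in>S. g u) - (\<Sum>u\<in>S. f u * g u)"
proof -
  have "pair_sum (\<lambda>u w. f u * g w) = (\<Sum>u\<in>S. f u * (\<Sum>w\<in>S. g w) - f u * g u)"
    unfolding pair_sum_def using finite_S
    by (intro sum.cong refl) (simp add: sum_diff1 right_diff_distrib flip: sum_distrib_left)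
  then show ?thesis by (simp add: sum_subtractf sum_distrib_right)
qed

text \<open>
  Each missing pair within \<open>S\<close> contributes to the codegrees of its two vertices.
\<close>

lemma codeg_sum:
  "(\<Sum>u\<in>S. real (codeg u) * f u) = pair_sum (\<lambda>u w. (1 - conn u w) * (f u + f w)) / 2"
proof -
  have "(\<Sum>u\<in>S. real (codeg u) * f u) = pair_sum (\<lambda>u w. (1 - conn u w) * f u)"
    unfolding pair_sum_def
  proof (intro sum.cong refl)
    fix u
    have "(\<Sum>w\<in>S - {u}. 1 - conn u w) = (\<Sum>w\<in>S - {u}. of_bool ((u, w) \<notin> parcs G))"
      by (intro sum.cong) auto
    also have "\<dots> = real (codeg u)"
      using finite_S by (simp add: Int_def)
    finally show "real (codeg u) * f u = (\<Sum>w\<in>S - {u}. (1 - conn u w) * f u)"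
      by (simp flip: sum_distrib_right)
  qed
  moreover have "pair_sum (\<lambda>u w. (1 - conn u w) * f u) = pair_sum (\<lambda>u w. (1 - conn u w) * f w)"
  proof -
    have "pair_sum (\<lambda>u w. (1 - conn u w) * f u) = pair_sum (\<lambda>u w. (1 - conn w u) * f w)"
      by (rule pair_sum_swap)
    also have "\<dots> = pair_sum (\<lambda>u w. (1 - conn u w) * f w)"
    proof (rule pair_sum_cong)
      fix u w show "(1 - conn w u) * f w = (1 - conn u w) * f w" by (subst conn_sym) (rule refl)
    qed
    finally show ?thesis .
  qed
  moreover have "a = (p + q) / 2" if "a = p" "p = q" for a p q :: real using that by simp
  ultimately show ?thesis unfolding distrib_left pair_sum_add by blast
qed

lemma graph_energy_cover:
  "graph_energy G x =
    pair_sum (\<lambda>u w. conn u w * (x u - x w)\<^sup>2) / 2 + (\<Sum>u\<in>S. \<Sum>v\<in>outer u. (x u - x v)\<^sup>2)"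
proof -
  let ?f = "\<lambda>u w. conn u w * (x u - x w)\<^sup>2"
  have sym: "?f u w = ?f w u" for u w using conn_sym[of u w] power2_commute[of "x u" "x w"] by metis
  have SS: "(\<Sum>u\<in>S. \<Sum>w\<in>S. ?f u w) = pair_sum ?f"
    unfolding pair_sum_def using finite_S by (intro sum.cong refl sum.mono_neutral_right) auto
  have "?f u w = 0" if "u \<in> T" "w \<in> T" for u w
  proof -
    have "(u, w) \<notin> parcs G" using T_neighbours that by blast
    then show ?thesis by simp
  qed
  then have TT: "(\<Sum>u\<in>T. \<Sum>w\<in>T. ?f u w) = 0" by (intro sum.neutral ballI)
  have TS: "(\<Sum>u\<in>T. \<Sum>w\<in>S. ?f u w) = (\<Sum>u\<in>S. \<Sum>w\<in>T. ?f u w)"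
    by (rule trans[OF sum.swap]) (intro sum.cong refl sym)
  have ST: "(\<Sum>u\<in>S. \<Sum>w\<in>T. ?f u w) = (\<Sum>u\<in>S. \<Sum>v\<in>outer u. (x u - x v)\<^sup>2)"
  proof (rule sum.cong[OF refl])
    fix u
    have "outer u = T \<inter> {v. (u, v) \<in> parcs G}" by auto
    then show "(\<Sum>w\<in>T. ?f u w) = (\<Sum>v\<in>outer u. (x u - x v)\<^sup>2)"
      using sum.inter_restrict[OF finite_T, of "\<lambda>v. (x u - x v)\<^sup>2" "{v. (u, v) \<in> parcs G}"]
      by (auto intro!: sum.cong)
  qed
  have "2 * graph_energy G x = (\<Sum>u\<in>S. \<Sum>w\<in>S. ?f u w) + (\<Sum>u\<in>S. \<Sum>w\<in>T. ?f u w)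
      + ((\<Sum>u\<in>T. \<Sum>w\<in>S. ?f u w) + (\<Sum>u\<in>T. \<Sum>w\<in>T. ?f u w))"
  proof -
    have "2 * ((a + b + (c + d)) / 2) = a + c + (b + d)" for a b c d :: real by simp
    then show ?thesis unfolding graph_energy_eq_sum_squares sum_vertices sum.distrib by blast
  qed
  then show ?thesis using SS TT TS ST by simp
qed

text \<open>
  This is what the vanishing of all pair terms amounts to: \<open>u\<close> can have no neighbour in \<open>S\<close>, so \<open>x\<close>
  is \<open>- x u\<close> everywhere else on \<open>S\<close>, and a third vertex of \<open>S\<close> would have to cancel against \<open>w\<close> too.
\<close>

lemma pairwise_vanishing:
  assumes adj: "\<And>u w. u \<in> S \<Longrightarrow> w \<in> S \<Longrightarrow> u \<noteq> w \<Longrightarrow> (u, w) \<in> parcs G \<Longrightarrow> x u = 0 \<and> x w = 0"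
    and non: "\<And>u w. u \<in> S \<Longrightarrow> w \<in> S \<Longrightarrow> u \<noteq> w \<Longrightarrow> (u, w) \<notin> parcs G \<Longrightarrow> x u + x w = (0::real)"
    and u: "u \<in> S" "x u \<noteq> 0" and w: "w \<in> S" "w \<noteq> u"
  shows "S = {u, w} \<and> (u, w) \<notin> parcs G \<and> x w = - x u"
proof -
  have opp: "(u, r) \<notin> parcs G \<and> x r = - x u" if "r \<in> S" "r \<noteq> u" for r
  proof -
    have "(u, r) \<notin> parcs G" using adj[of u r] u that by blast
    moreover from this have "x u + x r = 0" using non[of u r] u that by blast
    ultimately show ?thesis by linarith
  qed
  have "r = w" if "r \<in> S" "r \<noteq> u" for r
  proof (rule ccontr)
    assume "r \<noteq> w"
    then show False using adj[of r w] non[of r w] opp[OF that] opp[OF w] u that w by auto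
  qed
  then have "S = {u, w}" using u(1) w(1) by blast
  then show ?thesis using opp[OF w] by blast
qed

text \<open>
  One linear condition for each vertex outside \<open>S\<close> leaves a space of dimension \<open>card S\<close>. Each condition
  relates the value at its outer vertex to the values on \<open>S\<close>.
\<close>

lemma cover_test_function:
  fixes \<alpha> :: "'a \<Rightarrow> real" and g :: "'a \<Rightarrow> 'a \<Rightarrow> real"
  assumes ne: "S \<noteq> {}" and le: "laplacian_eigenvalue G (card S) \<le> t"
  shows "\<exists>x. (\<exists>v\<in>pverts G. x v \<noteq> 0) \<and> (\<forall>v\<in>T. \<alpha> v * x v + (\<Sum>u\<in>S. g v u * x u) = 0) \<and>
    graph_energy G x \<le> t * (\<Sum>v\<in>pverts G. (x v)\<^sup>2) \<and>
    (graph_energy G x = t * (\<Sum>v\<in>pverts G. (x v)\<^sup>2) \<longrightarrow>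
      (\<forall>v\<in>pverts G. graph_laplacian G x v = t * x v))"
proof -
  define C where "C v w = (if w \<in> S then g v w else if w = v then \<alpha> v else 0)" for v w
  have "card S \<ge> 1" using ne finite_S by (simp add: Suc_le_eq card_gt_0_iff)
  moreover have "card T + card S \<le> card (pverts G)"
    using S_subset pair_finite_verts by (simp add: card_Diff_subset finite_S card_mono)
  ultimately obtain x where x: "\<exists>v\<in>pverts G. x v \<noteq> 0" "\<forall>v\<in>T. (\<Sum>w\<in>pverts G. C v w * x w) = 0"
      "graph_energy G x \<le> t * (\<Sum>v\<in>pverts G. (x v)\<^sup>2)"
      "graph_energy G x = t * (\<Sum>v\<in>pverts G. (x v)\<^sup>2) \<longrightarrow>
        (\<forall>v\<in>pverts G. graph_laplacian G x v = t * x v)"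
    using laplacian_test_function[OF _ le finite_T, of C] by blast
  have "\<alpha> v * x v + (\<Sum>u\<in>S. g v u * x u) = 0" if v: "v \<in> T" for v
  proof -
    have "(\<Sum>w\<in>T. C v w * x w) = (\<Sum>w\<in>T. if w = v then \<alpha> v * x v else 0)"
      by (rule sum.cong[OF refl]) (simp add: C_def)
    also have "\<dots> = \<alpha> v * x v" using v finite_T by simp
    finally have T: "(\<Sum>w\<in>T. C v w * x w) = \<alpha> v * x v" .
    have "(\<Sum>w\<in>S. C v w * x w) = (\<Sum>u\<in>S. g v u * x u)"
      by (rule sum.cong[OF refl]) (simp add: C_def)
    then show ?thesis using bspec[OF x(2) v] T unfolding sum_vertices by linarith
  qed
  then show ?thesis using x(1,3,4) by blast
qed

end

section \<open>Positive excess\<close>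

context covered_graph
begin

text \<open>
  The contribution of a pair of vertices of \<open>S\<close> to the energy surplus over \<open>e + 1\<close>, where \<open>a\<close> is the mean
  of the test function over \<open>S\<close> and \<open>z\<close> its deviation from the mean. A missing
  pair comes with an additional outer edge at each end, which pays for the missing edge; the last
  summand is nonnegative for \<open>e \<ge> 1\<close>.
\<close>

definition pair_form :: "real \<Rightarrow> ('a \<Rightarrow> real) \<Rightarrow> 'a \<Rightarrow> 'a \<Rightarrow> real" where
  "pair_form a z u w =
    (if (u, w) \<in> parcs G then (z u)\<^sup>2 + (z w)\<^sup>2
     else (z u + z w + (real e + 1) / real e * a)\<^sup>2 + (real e + 1) * (real e - 1) * (a / real e)\<^sup>2)"

lemma pair_form_nonneg: "e \<ge> 1 \<Longrightarrow> pair_form a z u w \<ge> 0"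
  by (simp add: pair_form_def)

text \<open>
  Each \<open>u \<in> S\<close> has \<open>e + codeg u\<close> selected neighbours, all with the value \<open>- a / e\<close>. The \<open>e\<close> basic
  ones reduce the \<open>u\<close>-part of the surplus to minus the squared deviation \<open>z u\<close> (the step \<open>single\<close>). As the deviations
  sum to zero, the sum of these terms is a pair sum (the step \<open>zz\<close>), and together with the edges inside \<open>S\<close> and the
  \<open>codeg u\<close> additional selected neighbours it gives \<open>pair_form\<close>. The norm counts every vertex of
  \<open>T'\<close> once, whereas the selections count it with multiplicity; the last term records the difference.
\<close>

lemma surplus_identity:
  fixes R :: "'a \<Rightarrow> 'a set" and x :: "'a \<Rightarrow> real"
  assumes e: "e \<ge> 1" and ne: "S \<noteq> {}"
    and R: "\<And>u. u \<in> S \<Longrightarrow> R u \<subseteq> outer u" "\<And>u. u \<in> S \<Longrightarrow> card (R u) = e + codeg u"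
  defines "T' \<equiv> \<Union>u\<in>S. R u" and "a \<equiv> (\<Sum>u\<in>S. x u) / real (card S)"
  assumes xT: "\<And>v. v \<in> T \<Longrightarrow> x v = (if v \<in> T' then - a / real e else 0)"
  shows "2 * (graph_energy G x - (real e + 1) * (\<Sum>v\<in>pverts G. (x v)\<^sup>2)) =
    pair_sum (pair_form a (\<lambda>u. x u - a)) + 2 * (\<Sum>u\<in>S. \<Sum>v\<in>outer u - R u. (x u - x v)\<^sup>2)
      + 2 * (real e + 1) * (a / real e)\<^sup>2 * (real (\<Sum>u\<in>S. card (R u)) - real (card T'))"
proof -
  define E where "E = real e"
  define b where "b = a / E"
  define z where "z u = x u - a" for u
  define p where "p u = x u + b" for u
  define ex where "ex = (\<Sum>u\<in>S. \<Sum>v\<in>outer u - R u. (x u - x v)\<^sup>2)"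
  have E: "E \<ge> 1" using e by (simp add: E_def)
  have cS: "card S > 0" using ne finite_S by (simp add: card_gt_0_iff)
  have T'T: "T' \<subseteq> T" using R(1) unfolding T'_def by blast
  have outer: "(\<Sum>v\<in>outer u. (x u - x v)\<^sup>2) = (E + codeg u) * (p u)\<^sup>2 + (\<Sum>v\<in>outer u - R u. (x u - x v)\<^sup>2)"
    if u: "u \<in> S" for u
  proof -
    have "finite (outer u)" using finite_T by simp
    then have "(\<Sum>v\<in>outer u. (x u - x v)\<^sup>2) = (\<Sum>v\<in>outer u - R u. (x u - x v)\<^sup>2) + (\<Sum>v\<in>R u. (x u - x v)\<^sup>2)"
      by (rule sum.subset_diff[OF R(1)[OF u]])
    also have "(\<Sum>v\<in>R u. (x u - x v)\<^sup>2) = (\<Sum>v\<in>R u. (p u)\<^sup>2)"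
    proof (rule sum.cong[OF refl])
      fix v assume v: "v \<in> R u"
      then have "v \<in> T'" using u unfolding T'_def by blast
      moreover from this have "v \<in> T" using T'T by blast
      ultimately have "x v = - b" using xT[of v] by (simp add: b_def E_def)
      then show "(x u - x v)\<^sup>2 = (p u)\<^sup>2" by (simp add: p_def)
    qed
    also have "\<dots> = (E + codeg u) * (p u)\<^sup>2" using R(2)[OF u] by (simp add: E_def)
    finally show ?thesis by simp
  qed
  have sqT: "(\<Sum>v\<in>T. (x v)\<^sup>2) = real (card T') * b\<^sup>2"
  proof -
    have "(\<Sum>v\<in>T. (x v)\<^sup>2) = (\<Sum>v\<in>T'. b\<^sup>2)"
    proof (rule sum.mono_neutral_cong_right[OF finite_T T'T])
      show "\<forall>v\<in>T - T'. (x v)\<^sup>2 = 0" using xT by simp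
      show "(x v)\<^sup>2 = b\<^sup>2" if "v \<in> T'" for v
        using xT[of v] that T'T by (auto simp: b_def E_def)
    qed
    then show ?thesis by simp
  qed
  have sum_z: "(\<Sum>u\<in>S. z u) = 0" using cS by (simp add: z_def sum_subtractf a_def)
  have zz: "pair_sum (\<lambda>u w. 2 * (z u * z w)) = - 2 * (\<Sum>u\<in>S. (z u)\<^sup>2)"
    by (simp add: pair_sum_mult pair_sum_prod sum_z power2_eq_square)
  have single: "E * (p u)\<^sup>2 - (E + 1) * (x u)\<^sup>2 - (E + 1) * b\<^sup>2 * E = - (z u)\<^sup>2" for u
  proof -
    have ab: "a = E * b" using E by (simp add: b_def)
    show ?thesis unfolding p_def z_def ab by (simp add: power2_eq_square algebra_simps)
  qed
  have pair: "pair_form a z u w =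
      conn u w * (x u - x w)\<^sup>2 + (1 - conn u w) * (((p u)\<^sup>2 - (E + 1) * b\<^sup>2) + ((p w)\<^sup>2 - (E + 1) * b\<^sup>2)) + 2 * (z u * z w)"
    for u w
  proof -
    have ab: "a = E * b" "a / E = b" "(E + 1) / E * a = (E + 1) * b"
      using E by (simp_all add: b_def)
    show ?thesis
    proof (cases "(u, w) \<in> parcs G")
      case True
      then show ?thesis by (simp add: pair_form_def z_def power2_eq_square algebra_simps)
    next
      case False
      then have "pair_form a z u w = (z u + z w + (E + 1) * b)\<^sup>2 + (E + 1) * (E - 1) * b\<^sup>2"
        unfolding pair_form_def E_def[symmetric] ab(2,3) by simp
      then show ?thesis using False unfolding p_def z_def ab(1)
        by (simp add: power2_eq_square algebra_simps)
    qed
  qed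
  have cod: "2 * (\<Sum>u\<in>S. real (codeg u) * ((p u)\<^sup>2 - (E + 1) * b\<^sup>2)) =
      pair_sum (\<lambda>u w. (1 - conn u w) * (((p u)\<^sup>2 - (E + 1) * b\<^sup>2) + ((p w)\<^sup>2 - (E + 1) * b\<^sup>2)))"
    unfolding codeg_sum by simp
  have pf: "pair_sum (pair_form a z) = pair_sum (\<lambda>u w. conn u w * (x u - x w)\<^sup>2)
      + 2 * (\<Sum>u\<in>S. real (codeg u) * ((p u)\<^sup>2 - (E + 1) * b\<^sup>2)) - 2 * (\<Sum>u\<in>S. (z u)\<^sup>2)"
  proof -
    have "pair_form a z = (\<lambda>u w. conn u w * (x u - x w)\<^sup>2 +
        (1 - conn u w) * (((p u)\<^sup>2 - (E + 1) * b\<^sup>2) + ((p w)\<^sup>2 - (E + 1) * b\<^sup>2)) + 2 * (z u * z w))"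
      using pair by (intro ext)
    then show ?thesis by (simp only: pair_sum_add zz cod)
  qed
  have en: "graph_energy G x = pair_sum (\<lambda>u w. conn u w * (x u - x w)\<^sup>2) / 2
      + ((\<Sum>u\<in>S. (E + codeg u) * (p u)\<^sup>2) + ex)"
  proof -
    have "(\<Sum>u\<in>S. \<Sum>v\<in>outer u. (x u - x v)\<^sup>2) =
        (\<Sum>u\<in>S. (E + codeg u) * (p u)\<^sup>2 + (\<Sum>v\<in>outer u - R u. (x u - x v)\<^sup>2))"
      using outer by (rule sum.cong[OF refl])
    then show ?thesis unfolding graph_energy_cover ex_def by (simp only: sum.distrib)
  qed
  have cR: "real (\<Sum>u\<in>S. card (R u)) = (\<Sum>u\<in>S. E + codeg u)"
    using R(2) by (simp add: E_def)
  have key: "(\<Sum>u\<in>S. (E + codeg u) * (p u)\<^sup>2) - (E + 1) * (\<Sum>u\<in>S. (x u)\<^sup>2)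
      = (\<Sum>u\<in>S. real (codeg u) * ((p u)\<^sup>2 - (E + 1) * b\<^sup>2)) - (\<Sum>u\<in>S. (z u)\<^sup>2)
        + (E + 1) * b\<^sup>2 * (\<Sum>u\<in>S. E + codeg u)"
    unfolding sum_distrib_left sum_subtractf[symmetric] sum.distrib[symmetric]
  proof (rule sum.cong[OF refl])
    fix u
    show "(E + codeg u) * (p u)\<^sup>2 - (E + 1) * (x u)\<^sup>2
      = real (codeg u) * ((p u)\<^sup>2 - (E + 1) * b\<^sup>2) - (z u)\<^sup>2 + (E + 1) * b\<^sup>2 * (E + codeg u)"
      using single[of u] by (simp add: algebra_simps)
  qed
  have arith: "2 * (C / 2 + (P + e') - t * (X + c * q)) = C + 2 * D - 2 * Z + 2 * e' + 2 * t * q * (F - c)"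
    if "P - t * X = D - Z + t * q * F" for C P e' t X c q D Z F :: real
  proof -
    have P: "P = t * X + (D - Z + t * q * F)" using that by simp
    show ?thesis unfolding P by (simp add: algebra_simps)
  qed
  have "2 * (graph_energy G x - (E + 1) * (\<Sum>v\<in>pverts G. (x v)\<^sup>2)) =
      pair_sum (pair_form a z) + 2 * ex + 2 * (E + 1) * b\<^sup>2 * (real (\<Sum>u\<in>S. card (R u)) - real (card T'))"
    unfolding sum_vertices en sqT pf cR by (rule arith[OF key])
  then show ?thesis unfolding ex_def E_def b_def z_def .
qed

text \<open>
  All terms of \<open>surplus_identity\<close> are nonnegative, and the test function makes their sum at most zero,
  so each of them vanishes. For a pair \<open>u\<close>, \<open>w\<close> this forces \<open>z u + z w\<close> to be \<open>0\<close> if the pair is adjacent and a fixed nonzero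
  multiple of \<open>- a\<close> if not; since the deviations sum to zero, \<open>a\<close> times the number of missing
  pairs is zero. If \<open>a \<noteq> 0\<close>, then \<open>S\<close> is a clique on which the test function is constant,
  no edge is unselected and no outer vertex is selected twice. If \<open>a = 0\<close>, the test function lives on two
  nonadjacent vertices with opposite values, and being an eigenvector that vanishes on \<open>T\<close> it
  forces every outer vertex to see both of them.
\<close>

theorem positive_excess_structure:
  assumes e: "e \<ge> 1" and ne: "S \<noteq> {}" and le: "laplacian_eigenvalue G (card S) \<le> real e + 1"
  shows "(clique_with_pendants G S \<and> (\<forall>u\<in>S. card (outer u) = e)) \<or>
    (card S = 2 \<and> card T = e + 1 \<and> parcs G = S \<times> T \<union> T \<times> S)"
proof -
  have "\<exists>A. A \<subseteq> outer u \<and> card A = e + codeg u" if "u \<in> S" for u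
    using excess[OF that] by (meson obtain_subset_with_card_n)
  then have "\<forall>u\<in>S. \<exists>A. A \<subseteq> outer u \<and> card A = e + codeg u" by blast
  from bchoice[OF this] obtain R where "\<forall>u\<in>S. R u \<subseteq> outer u \<and> card (R u) = e + codeg u" by blast
  then have R: "\<And>u. u \<in> S \<Longrightarrow> R u \<subseteq> outer u" "\<And>u. u \<in> S \<Longrightarrow> card (R u) = e + codeg u"
    by blast+
  define T' where "T' = (\<Union>u\<in>S. R u)"
  have cS: "card S > 0" using ne finite_S by (simp add: card_gt_0_iff)
  obtain x where nz: "\<exists>v\<in>pverts G. x v \<noteq> 0"
    and con: "\<forall>v\<in>T. 1 * x v + (\<Sum>u\<in>S. (if v \<in> T' then 1 / (real e * real (card S)) else 0) * x u) = 0"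
    and small: "graph_energy G x \<le> (real e + 1) * (\<Sum>v\<in>pverts G. (x v)\<^sup>2)"
    and eig: "graph_energy G x = (real e + 1) * (\<Sum>v\<in>pverts G. (x v)\<^sup>2) \<longrightarrow>
        (\<forall>v\<in>pverts G. graph_laplacian G x v = (real e + 1) * x v)"
    using cover_test_function[OF ne le, of "\<lambda>_. 1" "\<lambda>v u. if v \<in> T' then 1 / (real e * real (card S)) else 0"] by blast
  define a where "a = (\<Sum>u\<in>S. x u) / real (card S)"
  have xT: "x v = (if v \<in> T' then - a / real e else 0)" if "v \<in> T" for v
  proof (cases "v \<in> T'")
    case True
    define K where "K = 1 / (real e * real (card S))"
    have "x v + (\<Sum>u\<in>S. K * x u) = 0"
      using bspec[OF con that] unfolding if_P[OF True] K_def[symmetric] by simp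
    moreover have "(\<Sum>u\<in>S. K * x u) = a / real e"
      unfolding sum_distrib_left[symmetric] a_def K_def by simp
    ultimately have "x v = - a / real e" by simp
    then show ?thesis using True by simp
  next
    case False
    then show ?thesis using bspec[OF con that] by simp
  qed
  define z where "z u = x u - a" for u
  define ex where "ex = (\<Sum>u\<in>S. \<Sum>v\<in>outer u - R u. (x u - x v)\<^sup>2)"
  define q where "q = (\<Sum>u\<in>S. card (R u))"
  have id: "2 * (graph_energy G x - (real e + 1) * (\<Sum>v\<in>pverts G. (x v)\<^sup>2)) =
    pair_sum (pair_form a z) + 2 * ex + 2 * (real e + 1) * (a / real e)\<^sup>2 * (real q - real (card T'))"
    unfolding z_def ex_def q_def a_def T'_def
    by (rule surplus_identity[OF e ne R]) (use xT in \<open>simp_all add: a_def T'_def\<close>)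
  have n1: "pair_sum (pair_form a z) \<ge> 0" using pair_form_nonneg[OF e] by (rule pair_sum_nonneg)
  have n2: "ex \<ge> 0" unfolding ex_def by (intro sum_nonneg) simp
  have "card T' \<le> q" unfolding T'_def q_def by (rule card_UN_le[OF finite_S])
  then have n3: "2 * (real e + 1) * (a / real e)\<^sup>2 * (real q - real (card T')) \<ge> 0" by simp
  \<comment> \<open>the surplus is a sum of nonnegative terms and at most zero\<close>
  have squeeze: "A = 0 \<and> B = 0 \<and> C = 0 \<and> X = Y"
    if "2 * (X - Y) = A + 2 * B + C" "A \<ge> 0" "B \<ge> 0" "C \<ge> 0" "X \<le> Y" for A B C X Y :: real
    using that by argo
  have z1: "pair_sum (pair_form a z) = 0" and z2: "ex = 0"
    and z3: "2 * (real e + 1) * (a / real e)\<^sup>2 * (real q - real (card T')) = 0"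
    and tight: "graph_energy G x = (real e + 1) * (\<Sum>v\<in>pverts G. (x v)\<^sup>2)"
    using squeeze[OF id n1 n2 n3 small] by blast+
  have form0: "pair_form a z u w = 0" if "u \<in> S" "w \<in> S" "u \<noteq> w" for u w
    using pair_sum_eq_0D[OF pair_form_nonneg[OF e] z1 that] .
  have c1: "z u = 0 \<and> z w = 0" if "u \<in> S" "w \<in> S" "u \<noteq> w" "(u, w) \<in> parcs G" for u w
    using form0[OF that(1-3)] that(4) by (simp add: pair_form_def sum_power2_eq_zero_iff)
  have c2: "z u + z w = - ((real e + 1) / real e * a)" if "u \<in> S" "w \<in> S" "u \<noteq> w" "(u, w) \<notin> parcs G" for u w
  proof -
    have "(z u + z w + (real e + 1) / real e * a)\<^sup>2 + (real e + 1) * (real e - 1) * (a / real e)\<^sup>2 = 0"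
      using form0[OF that(1-3)] that(4) by (simp add: pair_form_def)
    moreover have "(real e + 1) * (real e - 1) * (a / real e)\<^sup>2 \<ge> 0" using e by simp
    ultimately have "(z u + z w + (real e + 1) / real e * a)\<^sup>2 \<le> 0" by linarith
    then have "z u + z w + (real e + 1) / real e * a = 0" by simp
    then show ?thesis by linarith
  qed
  have c3: "x u = x v" if "u \<in> S" "v \<in> outer u - R u" for u v
  proof -
    have "\<forall>u\<in>S. (\<Sum>v\<in>outer u - R u. (x u - x v)\<^sup>2) = 0"
      using z2 finite_S unfolding ex_def by (subst sum_nonneg_eq_0_iff[symmetric]) (auto intro: sum_nonneg)
    then have "(\<Sum>v\<in>outer u - R u. (x u - x v)\<^sup>2) = 0" using that(1) by blast
    then have "(x u - x v)\<^sup>2 = 0"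
      using that(2) finite_T by (subst (asm) sum_nonneg_eq_0_iff) auto
    then show ?thesis by simp
  qed
  have sum_z: "(\<Sum>u\<in>S. z u) = 0" using cS by (simp add: z_def sum_subtractf a_def)
  show ?thesis
  proof (cases "a = 0")
    case False
    have clique: "(u, w) \<in> parcs G" if uw: "u \<in> S" "w \<in> S" "u \<noteq> w" for u w
    proof -
      define c where "c = (real e + 1) / real e * a"
      have c: "c \<noteq> 0" using False e by (simp add: c_def)
      \<comment> \<open>count the missing pairs by summing \<open>z u + z w\<close> over all pairs\<close>
      have "pair_sum (\<lambda>u w. - c * (1 - conn u w)) = pair_sum (\<lambda>u w. z u + z w)"
      proof (rule pair_sum_cong)
        fix u w assume "u \<in> S" "w \<in> S" "u \<noteq> w"
        then show "- c * (1 - conn u w) = z u + z w"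
          using c1[of u w] c2[of u w] by (cases "(u, w) \<in> parcs G") (simp_all add: c_def)
      qed
      also have "\<dots> = pair_sum (\<lambda>u w. z u) + pair_sum (\<lambda>u w. z w)" by (rule pair_sum_add)
      also have "pair_sum (\<lambda>u w. z w) = pair_sum (\<lambda>u w. z u)" by (rule pair_sum_swap)
      also have "pair_sum (\<lambda>u w. z u) + pair_sum (\<lambda>u w. z u) = 0" by (simp add: pair_sum_fst sum_z)
      finally have "pair_sum (\<lambda>u w. 1 - conn u w) = 0" unfolding pair_sum_mult using c by simp
      then have "1 - conn u w = 0" by (rule pair_sum_eq_0D[rotated]) (use uw in auto)
      then show ?thesis by (simp split: if_splits)
    qed
    have codeg0: "codeg u = 0" if "u \<in> S" for u
    proof -
      have "{w \<in> S - {u}. (u, w) \<notin> parcs G} = {}" using clique that by blast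
      then show ?thesis by (simp only: card.empty)
    qed
    have xa: "x u = a" if u: "u \<in> S" for u
    proof (cases "\<exists>w\<in>S. w \<noteq> u")
      case True
      then show ?thesis using c1[of u] clique[OF u] u unfolding z_def by force
    next
      case False
      then have "S = {u}" using u by blast
      then show ?thesis by (simp add: a_def)
    qed
    have Ru: "R u = outer u" if u: "u \<in> S" for u
    proof (rule ccontr)
      assume "R u \<noteq> outer u"
      then obtain v where v: "v \<in> outer u - R u" using R(1)[OF u] by blast
      then have "x v = a" using c3[OF u v] xa[OF u] by simp
      moreover have "x v = - a / real e \<or> x v = 0" using xT[of v] v by auto
      ultimately have "a * (real e + 1) = 0" using e \<open>a \<noteq> 0\<close> by (auto simp: field_simps)
      then show False using \<open>a \<noteq> 0\<close> by (simp add: add_nonneg_eq_0_iff)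
    qed
    have card_eq: "card T' = q" using z3 False e by simp
    have disj: "u = w" if uw: "u \<in> S" "w \<in> S" and v: "v \<in> R u" "v \<in> R w" for u w v
    proof (rule ccontr)
      assume "u \<noteq> w"
      have finR: "finite (R u)" if "u \<in> S" for u
      proof (rule finite_subset[OF _ finite_T])
        show "R u \<subseteq> T" using R(1)[OF that] by blast
      qed
      \<comment> \<open>a vertex selected twice would make \<open>T'\<close> smaller than the total number of selections\<close>
      have "T' = (\<Union>r\<in>S - {u}. R r) \<union> (R u - {v})"
        using uw v \<open>u \<noteq> w\<close> unfolding T'_def by blast
      then have "card T' \<le> card (\<Union>r\<in>S - {u}. R r) + card (R u - {v})" using card_Un_le by metis
      also have "card (\<Union>r\<in>S - {u}. R r) \<le> (\<Sum>r\<in>S - {u}. card (R r))"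
        by (rule card_UN_le) (simp add: finite_S)
      also have "card (R u - {v}) < card (R u)" using v(1) finR[OF uw(1)] by (rule card_Diff1_less[rotated])
      also have "(\<Sum>r\<in>S - {u}. card (R r)) + card (R u) = q"
        unfolding q_def using sum.remove[OF finite_S uw(1), of "\<lambda>r. card (R r)"] by simp
      finally show False using card_eq by simp
    qed
    have "\<exists>u\<in>S. {w. (v, w) \<in> parcs G} = {u}" if v: "v \<in> T" for v
    proof -
      obtain u where u: "(v, u) \<in> parcs G" using no_isolated v by blast
      have uS: "u \<in> S" using T_neighbours[OF v u] .
      have "w = u" if w: "(v, w) \<in> parcs G" for w
      proof -
        have "w \<in> S" using T_neighbours[OF v w] .
        moreover have "v \<in> outer w" "v \<in> outer u" using v w u arcs_symmetric by blast+
        ultimately show ?thesis using disj[of w u v] uS Ru by blast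
      qed
      then have "{w. (v, w) \<in> parcs G} = {u}" using u by blast
      then show ?thesis using uS by blast
    qed
    then have "clique_with_pendants G S"
      unfolding clique_with_pendants_def using S_subset clique by blast
    moreover have "card (outer u) = e" if "u \<in> S" for u
      using R(2)[OF that] Ru[OF that] codeg0[OF that] by simp
    ultimately show ?thesis by blast
  next
    case True
    have xT0: "x v = 0" if "v \<in> T" for v using xT[OF that] True by simp
    obtain u where u: "u \<in> S" "x u \<noteq> 0" using nz xT0 by blast
    have "\<exists>w\<in>S. w \<noteq> u"
    proof (rule ccontr)
      assume "\<not> ?thesis"
      then have "S = {u}" using u(1) by blast
      then show False using sum_z True u(2) by (simp add: z_def)
    qed
    then obtain w where w: "w \<in> S" "w \<noteq> u" by blast
    have adj: "x u = 0 \<and> x w = 0" if "u \<in> S" "w \<in> S" "u \<noteq> w" "(u, w) \<in> parcs G" for u w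
      using c1[OF that] True by (simp add: z_def)
    have non: "x u + x w = 0" if "u \<in> S" "w \<in> S" "u \<noteq> w" "(u, w) \<notin> parcs G" for u w
      using c2[OF that] True by (simp add: z_def)
    from pairwise_vanishing[of x, OF adj non u w]
    have S: "S = {u, w}" and uw: "(u, w) \<notin> parcs G" and xw: "x w = - x u" by blast+
    have wu: "(w, u) \<notin> parcs G" using uw arcs_symmetric by blast
    have lap: "graph_laplacian G x v = 0" if "v \<in> T" for v
      using eig tight that xT0 by simp
    have both: "(v, u) \<in> parcs G \<and> (v, w) \<in> parcs G" if v: "v \<in> T" for v
    proof -
      have sub: "{r. (v, r) \<in> parcs G} \<subseteq> {u, w}" using T_neighbours[OF v] S by blast
      obtain r where r: "(v, r) \<in> parcs G" using no_isolated v by blast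
      have "{r. (v, r) \<in> parcs G} \<noteq> {s}" if "s \<in> {u, w}" for s
      proof
        assume "{r. (v, r) \<in> parcs G} = {s}"
        then have "graph_laplacian G x v = x v - x s" by (simp add: graph_laplacian_def)
        then show False using lap[OF v] xT0[OF v] that u(2) xw by auto
      qed
      then have "{r. (v, r) \<in> parcs G} = {u, w}" using sub r by blast
      then show ?thesis by blast
    qed
    have outT: "outer u = T" using both arcs_symmetric by blast
    have "outer u - R u = {}"
    proof (rule ccontr)
      assume "outer u - R u \<noteq> {}"
      then obtain v where "v \<in> outer u - R u" by blast
      then show False using c3[OF u(1)] xT0 u(2) by force
    qed
    then have "R u = T" using R(1)[OF u(1)] outT by blast
    moreover have "codeg u = 1"
    proof -
      have "{r \<in> S - {u}. (u, r) \<notin> parcs G} = {w}" using S w uw by blast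
      moreover have "card {w} = 1" by simp
      ultimately show ?thesis by (simp only:)
    qed
    ultimately have "card T = e + 1" using R(2)[OF u(1)] by (simp only:)
    moreover have "parcs G = S \<times> T \<union> T \<times> S"
    proof
      show "S \<times> T \<union> T \<times> S \<subseteq> parcs G" using both S arcs_symmetric by blast
      show "parcs G \<subseteq> S \<times> T \<union> T \<times> S"
      proof (rule subrelI)
        fix r s assume rs: "(r, s) \<in> parcs G"
        then have "r \<noteq> s" "r \<in> pverts G" "s \<in> pverts G"
          using no_loops' in_arcsD1 in_arcsD2 by blast+
        then show "(r, s) \<in> S \<times> T \<union> T \<times> S" using rs cover[OF rs] S uw wu by blast
      qed
    qed
    moreover have "card S = 2" using S w by simp
    ultimately show ?thesis by blast
  qed
qed

end

section \<open>Zero excess\<close>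

context covered_graph
begin

text \<open>
  In contrast to \<open>surplus_identity\<close> no condition on \<open>x\<close> is imposed, and the outer vertices are kept apart. The surplus at
  an outer vertex is a quadratic polynomial in its value, and the conditions of the next
  two lemmas are chosen to make the resulting values nonnegative.
\<close>

lemma energy_expansion:
  "2 * (graph_energy G x - t * (\<Sum>v\<in>pverts G. (x v)\<^sup>2)) =
    pair_sum (\<lambda>u w. conn u w * (x u - x w)\<^sup>2 + (1 - conn u w) * ((x u)\<^sup>2 + (x w)\<^sup>2))
    + 2 * (\<Sum>u\<in>S. (real (card (outer u)) - real (codeg u) - t) * (x u)\<^sup>2)
    + 2 * (\<Sum>v\<in>T. ((\<Sum>u\<in>S. conn u v) - t) * (x v)\<^sup>2 - 2 * x v * (\<Sum>u\<in>S. conn u v * x u))"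
proof -
  have out: "(\<Sum>v\<in>outer u. h v) = (\<Sum>v\<in>T. conn u v * h v)" for u and h :: "'a \<Rightarrow> real"
  proof -
    have "(\<Sum>v\<in>outer u. h v) = (\<Sum>v\<in>T. if (u, v) \<in> parcs G then h v else 0)"
      by (rule sum.inter_filter[OF finite_T])
    also have "\<dots> = (\<Sum>v\<in>T. conn u v * h v)" by (rule sum.cong[OF refl]) simp
    finally show ?thesis .
  qed
  have "(\<Sum>u\<in>S. \<Sum>v\<in>outer u. (x u - x v)\<^sup>2) =
      (\<Sum>u\<in>S. real (card (outer u)) * (x u)\<^sup>2 + (\<Sum>v\<in>T. conn u v * (x v)\<^sup>2 - 2 * x v * (conn u v * x u)))"
  proof (rule sum.cong[OF refl])
    fix u
    have "(\<Sum>v\<in>outer u. (x u - x v)\<^sup>2) = (\<Sum>v\<in>outer u. (x u)\<^sup>2 + ((x v)\<^sup>2 - 2 * x v * x u))"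
      by (rule sum.cong[OF refl]) (simp add: power2_eq_square algebra_simps)
    also have "\<dots> = (\<Sum>v\<in>outer u. (x u)\<^sup>2) + (\<Sum>v\<in>outer u. (x v)\<^sup>2 - 2 * x v * x u)"
      by (rule sum.distrib)
    also have "(\<Sum>v\<in>outer u. (x v)\<^sup>2 - 2 * x v * x u) = (\<Sum>v\<in>T. conn u v * (x v)\<^sup>2 - 2 * x v * (conn u v * x u))"
      unfolding out by (rule sum.cong[OF refl]) (simp only: right_diff_distrib mult_ac)
    finally show "(\<Sum>v\<in>outer u. (x u - x v)\<^sup>2) = real (card (outer u)) * (x u)\<^sup>2
        + (\<Sum>v\<in>T. conn u v * (x v)\<^sup>2 - 2 * x v * (conn u v * x u))"
      by simp
  qed
  also have "\<dots> = (\<Sum>u\<in>S. real (card (outer u)) * (x u)\<^sup>2)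
      + (\<Sum>v\<in>T. \<Sum>u\<in>S. conn u v * (x v)\<^sup>2 - 2 * x v * (conn u v * x u))"
    unfolding sum.distrib by (subst sum.swap) (rule refl)
  also have "(\<Sum>v\<in>T. \<Sum>u\<in>S. conn u v * (x v)\<^sup>2 - 2 * x v * (conn u v * x u)) =
      (\<Sum>v\<in>T. (\<Sum>u\<in>S. conn u v) * (x v)\<^sup>2 - 2 * x v * (\<Sum>u\<in>S. conn u v * x u))"
    unfolding sum_subtractf sum_distrib_left sum_distrib_right ..
  finally have en: "graph_energy G x = pair_sum (\<lambda>u w. conn u w * (x u - x w)\<^sup>2) / 2
      + ((\<Sum>u\<in>S. real (card (outer u)) * (x u)\<^sup>2)
      + (\<Sum>v\<in>T. (\<Sum>u\<in>S. conn u v) * (x v)\<^sup>2 - 2 * x v * (\<Sum>u\<in>S. conn u v * x u)))"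
    unfolding graph_energy_cover by (rule arg_cong)
  have cod: "pair_sum (\<lambda>u w. (1 - conn u w) * ((x u)\<^sup>2 + (x w)\<^sup>2)) = 2 * (\<Sum>u\<in>S. real (codeg u) * (x u)\<^sup>2)"
    unfolding codeg_sum by simp
  have s1: "(\<Sum>u\<in>S. (real (card (outer u)) - real (codeg u) - t) * (x u)\<^sup>2) =
      (\<Sum>u\<in>S. real (card (outer u)) * (x u)\<^sup>2) - (\<Sum>u\<in>S. real (codeg u) * (x u)\<^sup>2) - t * (\<Sum>u\<in>S. (x u)\<^sup>2)"
    unfolding left_diff_distrib sum_subtractf sum_distrib_left ..
  have s2: "(\<Sum>v\<in>T. ((\<Sum>u\<in>S. conn u v) - t) * (x v)\<^sup>2 - 2 * x v * (\<Sum>u\<in>S. conn u v * x u)) =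
      (\<Sum>v\<in>T. (\<Sum>u\<in>S. conn u v) * (x v)\<^sup>2 - 2 * x v * (\<Sum>u\<in>S. conn u v * x u)) - t * (\<Sum>v\<in>T. (x v)\<^sup>2)"
    unfolding sum_distrib_left[of t "\<lambda>v. (x v)\<^sup>2" T] sum_subtractf[symmetric]
    by (rule sum.cong[OF refl]) (simp only: left_diff_distrib diff_right_commute)
  have "2 * (C / 2 + (P + Q) - t * (X + Y)) = C + 2 * D + 2 * (P - D - t * X) + 2 * (Q - t * Y)"
    for C P Q X Y D :: real by (simp add: algebra_simps)
  then show ?thesis unfolding sum_vertices en pair_sum_add cod s1 s2 by blast
qed

lemma pair_sum_prod_swapped:
  "pair_sum (\<lambda>u w. f w * g u) = (\<Sum>u\<in>S. f u) * (\<Sum>u\<in>S. g u) - (\<Sum>u\<in>S. f u * g u)"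
proof -
  have "pair_sum (\<lambda>u w. f w * g u) = pair_sum (\<lambda>u w. f u * g w)" by (rule pair_sum_swap)
  then show ?thesis unfolding pair_sum_prod .
qed

text \<open>
  The test function is free at \<open>v\<close>, zero at the other outer vertices, and sums to zero over the
  neighbours of \<open>v\<close>. This decouples \<open>x v\<close>, which contributes \<open>(c - 1) (x v)\<^sup>2\<close> where \<open>c \<ge> 2\<close> is the degree of \<open>v\<close>.
  Writing \<open>\<alpha>\<close> for the indicator of the neighbourhood of \<open>v\<close>, the product of \<open>\<Sum> \<alpha> x\<close> and \<open>\<Sum> x\<close> vanishes and may be
  added to the form on \<open>S\<close>; afterwards each pair with exactly one vertex in the neighbourhood can give
  up half the sum of its two squares, and what is left of every pair is a nonnegative form \<open>\<rho>\<close>. The pairs meeting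
  the neighbourhood in one vertex compensate the deficit of the vertices outside it. Vanishing of all terms
  leaves only two nonadjacent vertices joined through \<open>v\<close>.
\<close>

lemma outer_vertex_with_two_neighbours:
  assumes e: "e = 0" and le: "laplacian_eigenvalue G (card S) \<le> 1"
    and v: "v \<in> T" and pq: "(p, v) \<in> parcs G" "(q, v) \<in> parcs G" "p \<noteq> q"
  shows "\<exists>u w. u \<noteq> w \<and> pverts G = {u, v, w} \<and> S = {u, w} \<and> parcs G = {(u, v), (v, u), (w, v), (v, w)}"
proof -
  have pqS: "p \<in> S" "q \<in> S" using pq v arcs_symmetric T_neighbours by blast+
  then have ne: "S \<noteq> {}" by blast
  obtain x where nz: "\<exists>v\<in>pverts G. x v \<noteq> 0"
    and con: "\<forall>r\<in>T. (if r = v then 0 else 1) * x r + (\<Sum>u\<in>S. (if r = v then conn u v else 0) * x u) = 0"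
    and small: "graph_energy G x \<le> 1 * (\<Sum>v\<in>pverts G. (x v)\<^sup>2)"
    using cover_test_function[OF ne le, of "\<lambda>r. if r = v then 0 else 1" "\<lambda>r u. if r = v then conn u v else 0"] by blast
  define \<alpha> where "\<alpha> u = conn u v" for u
  have \<alpha>01: "\<alpha> u = 0 \<or> \<alpha> u = 1" for u by (simp add: \<alpha>_def)
  have x0: "x r = 0" if "r \<in> T" "r \<noteq> v" for r using bspec[OF con that(1)] that(2) by simp
  have ortho: "(\<Sum>u\<in>S. \<alpha> u * x u) = 0" using bspec[OF con v] by (simp add: \<alpha>_def)
  define c where "c = (\<Sum>u\<in>S. \<alpha> u)"
  define b where "b = (\<Sum>u\<in>S. 1 - \<alpha> u)"
  define XA where "XA = (\<Sum>u\<in>S. \<alpha> u * (x u)\<^sup>2)"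
  define XB where "XB = (\<Sum>u\<in>S. (1 - \<alpha> u) * (x u)\<^sup>2)"
  have XAB: "(\<Sum>u\<in>S. (x u)\<^sup>2) = XA + XB"
    unfolding XA_def XB_def sum.distrib[symmetric] by (rule sum.cong[OF refl]) (simp add: algebra_simps)
  have XA0: "XA \<ge> 0" and XB0: "XB \<ge> 0" and b0: "b \<ge> 0"
    unfolding XA_def XB_def b_def by (intro sum_nonneg; simp add: \<alpha>_def)+
  have c2: "c \<ge> 2"
  proof -
    have "(\<Sum>u\<in>{p, q}. \<alpha> u) \<le> c"
      unfolding c_def by (rule sum_mono2) (use pqS finite_S in \<open>auto simp: \<alpha>_def\<close>)
    then show ?thesis using pq by (simp add: \<alpha>_def)
  qed
  define \<psi> where "\<psi> u w = conn u w * (x u - x w)\<^sup>2 + (1 - conn u w) * ((x u)\<^sup>2 + (x w)\<^sup>2)" for u w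
  \<comment> \<open>the products \<open>\<alpha> u * x u * x w\<close> sum to minus the \<open>\<alpha>\<close>-weighted squares; the halved part is what mixed pairs give up\<close>
  define \<rho> where "\<rho> u w = \<psi> u w + (\<alpha> u * x u * x w + \<alpha> w * x w * x u)
      - 1 / 2 * ((\<alpha> u * (x u)\<^sup>2 * (1 - \<alpha> w) + \<alpha> w * (x w)\<^sup>2 * (1 - \<alpha> u))
        + (\<alpha> u * ((1 - \<alpha> w) * (x w)\<^sup>2) + \<alpha> w * ((1 - \<alpha> u) * (x u)\<^sup>2)))" for u w
  have \<rho>: "\<rho> u w = (if \<alpha> u = 1 \<and> \<alpha> w = 1 then
        (if (u, w) \<in> parcs G then (x u)\<^sup>2 + (x w)\<^sup>2 else (x u + x w)\<^sup>2)
      else if \<alpha> u = 1 \<or> \<alpha> w = 1 then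
        (if (u, w) \<in> parcs G then (x u - x w)\<^sup>2 / 2 else (x u + x w)\<^sup>2 / 2)
      else \<psi> u w)" for u w
    using \<alpha>01[of u] \<alpha>01[of w]
    by (elim disjE; cases "(u, w) \<in> parcs G")
      (simp_all add: \<rho>_def \<psi>_def power2_eq_square algebra_simps)
  have \<psi>0: "\<psi> u w \<ge> 0" for u w by (simp add: \<psi>_def)
  have \<rho>0: "\<rho> u w \<ge> 0" for u w unfolding \<rho> using \<psi>0[of u w] by simp
  have zprod: "\<alpha> u * h * (1 - \<alpha> u) = 0" "\<alpha> u * ((1 - \<alpha> u) * h) = 0" for u h
    using \<alpha>01[of u] by auto
  have sum\<rho>: "pair_sum \<rho> = pair_sum \<psi> - 2 * XA - (b * XA + c * XB)"
  proof -
    have "pair_sum \<rho> = pair_sum (\<lambda>u w. \<psi> u w + ((\<alpha> u * x u * x w + \<alpha> w * x w * x u)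
      + - 1 / 2 * ((\<alpha> u * (x u)\<^sup>2 * (1 - \<alpha> w) + \<alpha> w * (x w)\<^sup>2 * (1 - \<alpha> u))
        + (\<alpha> u * ((1 - \<alpha> w) * (x w)\<^sup>2) + \<alpha> w * ((1 - \<alpha> u) * (x u)\<^sup>2)))))"
      by (rule pair_sum_cong) (simp add: \<rho>_def)
    also have "\<dots> = pair_sum \<psi> + (2 * (0 * (\<Sum>u\<in>S. x u) - (\<Sum>u\<in>S. \<alpha> u * x u * x u))
        + - 1 / 2 * (2 * (XA * b - 0) + 2 * (c * XB - 0)))"
      unfolding pair_sum_add pair_sum_mult pair_sum_prod pair_sum_prod_swapped zprod ortho
        XA_def[symmetric] XB_def[symmetric] b_def[symmetric] c_def[symmetric] by simp
    also have "(\<Sum>u\<in>S. \<alpha> u * x u * x u) = XA"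
      unfolding XA_def by (rule sum.cong[OF refl]) (simp add: power2_eq_square)
    finally show ?thesis by (simp add: algebra_simps)
  qed
  define W where "W = (\<Sum>u\<in>S. (real (card (outer u)) - real (codeg u)) * (x u)\<^sup>2)"
  have surplus: "real (card (outer u)) - real (codeg u) \<ge> 0" if "u \<in> S" for u
    using excess[OF that] e by simp
  have W0: "W \<ge> 0" unfolding W_def using surplus by (intro sum_nonneg mult_nonneg_nonneg) auto
  have Wt: "(\<Sum>u\<in>S. (real (card (outer u)) - real (codeg u) - 1) * (x u)\<^sup>2) = W - (XA + XB)"
    unfolding W_def XAB[symmetric] sum_subtractf[symmetric]
    by (rule sum.cong[OF refl]) (simp add: algebra_simps)
  have Tt: "(\<Sum>r\<in>T. ((\<Sum>u\<in>S. conn u r) - 1) * (x r)\<^sup>2 - 2 * x r * (\<Sum>u\<in>S. conn u r * x u)) = (c - 1) * (x v)\<^sup>2"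
  proof -
    have "(\<Sum>r\<in>T. ((\<Sum>u\<in>S. conn u r) - 1) * (x r)\<^sup>2 - 2 * x r * (\<Sum>u\<in>S. conn u r * x u)) =
        (\<Sum>r\<in>T. if r = v then (c - 1) * (x v)\<^sup>2 else 0)"
    proof (rule sum.cong[OF refl])
      fix r assume r: "r \<in> T"
      show "((\<Sum>u\<in>S. conn u r) - 1) * (x r)\<^sup>2 - 2 * x r * (\<Sum>u\<in>S. conn u r * x u) =
          (if r = v then (c - 1) * (x v)\<^sup>2 else 0)"
      proof (cases "r = v")
        case True
        show ?thesis unfolding True \<alpha>_def[symmetric] ortho c_def[symmetric] by simp
      next
        case False
        then show ?thesis using x0[OF r False] by simp
      qed
    qed
    also have "\<dots> = (c - 1) * (x v)\<^sup>2" using v finite_T by simp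
    finally show ?thesis .
  qed
  have id: "2 * (graph_energy G x - 1 * (\<Sum>v\<in>pverts G. (x v)\<^sup>2)) =
      pair_sum \<psi> + 2 * (W - (XA + XB)) + 2 * ((c - 1) * (x v)\<^sup>2)"
    unfolding energy_expansion Wt Tt \<psi>_def ..
  have n1: "pair_sum \<rho> \<ge> 0" using \<rho>0 by (rule pair_sum_nonneg)
  have n2: "b * XA \<ge> 0" "(c - 2) * XB \<ge> 0" "(c - 1) * (x v)\<^sup>2 \<ge> 0" using b0 XA0 XB0 c2 by simp_all
  have squeeze: "R = 0 \<and> B = 0 \<and> Y = 0 \<and> W' = 0"
    if "2 * (F - H) = P + 2 * (W' - (A + D)) + 2 * Y" "R = P - 2 * A - (B + c * D)" "F \<le> H"
      "R \<ge> 0" "B \<ge> 0" "(c - 2) * D \<ge> 0" "Y \<ge> 0" "W' \<ge> 0" for F H P W' A B D Y R :: real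
  proof -
    define E where "E = c * D"
    have "E - 2 * D \<ge> 0" using that(6) by (simp add: E_def left_diff_distrib)
    then show ?thesis using that(1-5,7,8) unfolding E_def[symmetric] by argo
  qed
  from squeeze[OF id sum\<rho> small n1 n2 W0]
  have z: "pair_sum \<rho> = 0" "b * XA = 0" "(c - 1) * (x v)\<^sup>2 = 0" "W = 0" by blast+
  have xv: "x v = 0" using z(3) c2 by simp
  have \<rho>z: "\<rho> u w = 0" if "u \<in> S" "w \<in> S" "u \<noteq> w" for u w
    using pair_sum_eq_0D[OF \<rho>0 z(1) that] .
  have xT: "x r = 0" if "r \<in> T" for r using xv x0[OF that] by blast
  obtain u where u: "u \<in> S" "x u \<noteq> 0" using nz xT by blast
  \<comment> \<open>otherwise the test function vanishes on the neighbourhood, and then, by the mixed pairs, on all of \<open>S\<close>\<close>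
  have all\<alpha>: "\<alpha> w = 1" if w: "w \<in> S" for w
  proof (rule ccontr)
    assume "\<alpha> w \<noteq> 1"
    then have "\<alpha> w = 0" using \<alpha>01 by blast
    then have "1 \<le> b" unfolding b_def
      using member_le_sum[of w S "\<lambda>u. 1 - \<alpha> u"] w finite_S by (simp add: \<alpha>_def)
    then have "XA = 0" using z(2) by simp
    then have "\<forall>r\<in>S. \<alpha> r * (x r)\<^sup>2 = 0"
      unfolding XA_def by (subst (asm) sum_nonneg_eq_0_iff[OF finite_S]) (simp_all add: \<alpha>_def)
    then have A0: "x r = 0" if "r \<in> S" "\<alpha> r = 1" for r using that by fastforce
    have \<alpha>p: "\<alpha> p = 1" using pq by (simp add: \<alpha>_def)
    have xp: "x p = 0" using A0[OF pqS(1) \<alpha>p] .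
    have "\<alpha> u \<noteq> 1" using A0[OF u(1)] u(2) by blast
    then have "\<rho> p u \<noteq> 0" unfolding \<rho> using \<alpha>p xp u(2) by simp
    moreover have "p \<noteq> u" using xp u(2) by blast
    ultimately show False using \<rho>z[OF pqS(1) u(1)] by blast
  qed
  have adj: "x u = 0 \<and> x w = 0" if "u \<in> S" "w \<in> S" "u \<noteq> w" "(u, w) \<in> parcs G" for u w
    using \<rho>z[OF that(1-3)] that(4) all\<alpha>[OF that(1)] all\<alpha>[OF that(2)]
    unfolding \<rho> by (simp add: sum_power2_eq_zero_iff)
  have non: "x u + x w = 0" if "u \<in> S" "w \<in> S" "u \<noteq> w" "(u, w) \<notin> parcs G" for u w
    using \<rho>z[OF that(1-3)] that(4) all\<alpha>[OF that(1)] all\<alpha>[OF that(2)] unfolding \<rho> by simp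
  obtain w where w: "w \<in> S" "w \<noteq> u" using pqS pq(3) by metis
  from pairwise_vanishing[of x, OF adj non u w]
  have S: "S = {u, w}" and uw: "(u, w) \<notin> parcs G" and xw: "x w = - x u" by blast+
  have wu: "(w, u) \<notin> parcs G" using uw arcs_symmetric by blast
  have Wz: "(real (card (outer r)) - real (codeg r)) * (x r)\<^sup>2 = 0" if "r \<in> S" for r
  proof -
    have "\<forall>r\<in>S. (real (card (outer r)) - real (codeg r)) * (x r)\<^sup>2 = 0"
      using z(4) unfolding W_def
      by (subst (asm) sum_nonneg_eq_0_iff[OF finite_S]) (use surplus in simp_all)
    then show ?thesis using that by blast
  qed
  have out1: "outer r = {v}" if r: "r \<in> {u, w}" for r
  proof -
    have rS: "r \<in> S" using r S by blast
    have "x r \<noteq> 0" using r u(2) xw by auto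
    then have "card (outer r) = codeg r" using Wz[OF rS] by simp
    moreover have "codeg r = 1"
    proof -
      have "{s \<in> S - {r}. (r, s) \<notin> parcs G} = {if r = u then w else u}" using S w(2) uw wu r by auto
      moreover have "card {if r = u then w else u} = 1" by simp
      ultimately show ?thesis by (simp only:)
    qed
    moreover have "v \<in> outer r" using all\<alpha>[OF rS] v by (simp add: \<alpha>_def)
    ultimately show ?thesis by (metis card_1_singletonE singletonD)
  qed
  have T: "T = {v}"
  proof -
    have "r = v" if r: "r \<in> T" for r
    proof -
      obtain s where s: "(r, s) \<in> parcs G" using no_isolated r by blast
      then have "s \<in> {u, w}" using T_neighbours[OF r] S by blast
      moreover have "r \<in> outer s" using s r arcs_symmetric by blast
      ultimately show ?thesis using out1 by blast
    qed
    then show ?thesis using v by blast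
  qed
  have V: "pverts G = {u, v, w}" using T S S_subset by blast
  have uv: "(u, v) \<in> parcs G" "(w, v) \<in> parcs G" using out1 by blast+
  have "parcs G = {(u, v), (v, u), (w, v), (v, w)}"
  proof
    show "{(u, v), (v, u), (w, v), (v, w)} \<subseteq> parcs G" using uv arcs_symmetric by blast
    show "parcs G \<subseteq> {(u, v), (v, u), (w, v), (v, w)}"
    proof (rule subrelI)
      fix r s assume rs: "(r, s) \<in> parcs G"
      then have "r \<noteq> s" "r \<in> {u, v, w}" "s \<in> {u, v, w}"
        using no_loops' in_arcsD1 in_arcsD2 V by blast+
      then show "(r, s) \<in> {(u, v), (v, u), (w, v), (v, w)}" using rs uw wu by blast
    qed
  qed
  then show ?thesis using V S w(2) by blast
qed

text \<open>
  Suppose pendant vertices \<open>p'\<close> and \<open>q'\<close> hang at different vertices \<open>p\<close> and \<open>q\<close>. For \<open>t = 1\<close> the square of the value at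
  a pendant vertex cancels, and only its product with the value at its neighbour remains. Setting \<open>x p' = - K x p\<close> and
  \<open>x q' = - K x q\<close> therefore gains an arbitrarily large multiple of \<open>(x p)\<^sup>2 + (x q)\<^sup>2\<close>, and every other vertex of \<open>S\<close> is
  controlled through its two pairs with \<open>p\<close> and \<open>q\<close>. So the form is positive definite, which is impossible.
\<close>

lemma pendants_at_one_vertex:
  assumes le: "laplacian_eigenvalue G (card S) \<le> 1" and e: "e = 0"
    and pend: "\<And>v. v \<in> T \<Longrightarrow> \<exists>u\<in>S. {w. (v, w) \<in> parcs G} = {u}"
    and p: "p \<in> S" "p' \<in> outer p" and q: "q \<in> S" "q' \<in> outer q"
  shows "p = q"
proof (rule ccontr)
  assume pq: "p \<noteq> q"
  have ne: "S \<noteq> {}" using p by blast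
  \<comment> \<open>large enough to outweigh the loss of \<open>3 (x p)\<^sup>2\<close> or \<open>3 (x q)\<^sup>2\<close> in each of the pairs that meet \<open>p\<close> or \<open>q\<close>\<close>
  define K where "K = 3 * real (card S) / 2"
  define g where "g r u = (if r = p' \<and> u = p \<or> r = q' \<and> u = q then K else 0)" for r u
  obtain x where nz: "\<exists>v\<in>pverts G. x v \<noteq> 0"
    and con: "\<forall>r\<in>T. 1 * x r + (\<Sum>u\<in>S. g r u * x u) = 0"
    and small: "graph_energy G x \<le> 1 * (\<Sum>v\<in>pverts G. (x v)\<^sup>2)"
    using cover_test_function[OF ne le, of "\<lambda>_. 1" g] by blast
  have nbr: "u = w" if v: "v \<in> T" and "(u, v) \<in> parcs G" "(w, v) \<in> parcs G" for u v w
  proof -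
    from that have "(v, u) \<in> parcs G" "(v, w) \<in> parcs G" using arcs_symmetric by blast+
    moreover obtain s where "{w. (v, w) \<in> parcs G} = {s}" using pend[OF v] by blast
    ultimately have "u = s" "w = s" by blast+
    then show ?thesis by simp
  qed
  have p'q': "p' \<noteq> q'" using nbr p q pq by blast
  have xp': "x p' = - K * x p" and xq': "x q' = - K * x q" and x0: "\<And>r. r \<in> T \<Longrightarrow> r \<noteq> p' \<Longrightarrow> r \<noteq> q' \<Longrightarrow> x r = 0"
  proof -
    have "(\<Sum>u\<in>S. g p' u * x u) = (\<Sum>u\<in>S. if u = p then K * x p else 0)"
      by (rule sum.cong[OF refl]) (use p'q' in \<open>simp add: g_def\<close>)
    then have gp: "(\<Sum>u\<in>S. g p' u * x u) = K * x p" using p(1) finite_S by simp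
    have "1 * x p' + (\<Sum>u\<in>S. g p' u * x u) = 0" using con p(2) by blast
    then show "x p' = - K * x p" unfolding gp by simp
    have "(\<Sum>u\<in>S. g q' u * x u) = (\<Sum>u\<in>S. if u = q then K * x q else 0)"
      by (rule sum.cong[OF refl]) (use p'q' in \<open>simp add: g_def\<close>)
    then have gq: "(\<Sum>u\<in>S. g q' u * x u) = K * x q" using q(1) finite_S by simp
    have "1 * x q' + (\<Sum>u\<in>S. g q' u * x u) = 0" using con q(2) by blast
    then show "x q' = - K * x q" unfolding gq by simp
    show "x r = 0" if "r \<in> T" "r \<noteq> p'" "r \<noteq> q'" for r
      using bspec[OF con that(1)] that(2,3) by (simp add: g_def)
  qed
  define P where "P = (x p)\<^sup>2 + (x q)\<^sup>2"
  define X where "X = (\<Sum>u\<in>S. (x u)\<^sup>2)"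
  define \<beta> :: "'a \<Rightarrow> real" where "\<beta> u = (if u = p then 1 else 0) + (if u = q then 1 else 0)" for u
  have \<beta>sum: "(\<Sum>u\<in>S. \<beta> u * h u) = h p + h q" for h
    unfolding \<beta>_def distrib_right sum.distrib
    using p(1) q(1) finite_S by (simp add: if_distrib[of "\<lambda>a. a * _"] cong: if_cong)
  have \<beta>card: "(\<Sum>u\<in>S. \<beta> u) = 2" using \<beta>sum[of "\<lambda>_. 1"] by simp
  have \<beta>01: "\<beta> u = 0 \<or> \<beta> u = 1" for u using pq by (simp add: \<beta>_def)
  define \<psi> where "\<psi> u w = conn u w * (x u - x w)\<^sup>2 + (1 - conn u w) * ((x u)\<^sup>2 + (x w)\<^sup>2)" for u w
  have \<psi>0: "\<psi> u w \<ge> 0" for u w by (simp add: \<psi>_def)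
  \<comment> \<open>two such pairs give \<open>3 / 2 > 1\<close> times the square at a vertex outside \<open>{p, q}\<close>\<close>
  have low: "\<psi> u w \<ge> 3 / 4 * (x w)\<^sup>2 - 3 * (x u)\<^sup>2" "\<psi> u w \<ge> 3 / 4 * (x u)\<^sup>2 - 3 * (x w)\<^sup>2" for u w
  proof -
    have sq: "(a - b)\<^sup>2 \<ge> 3 / 4 * b\<^sup>2 - 3 * a\<^sup>2" for a b :: real
    proof -
      have "(a - b)\<^sup>2 - (3 / 4 * b\<^sup>2 - 3 * a\<^sup>2) = (2 * a - b / 2)\<^sup>2"
        by (simp add: power2_eq_square algebra_simps)
      then show ?thesis using zero_le_power2[of "2 * a - b / 2"] by argo
    qed
    have sq': "a\<^sup>2 + b\<^sup>2 \<ge> 3 / 4 * b\<^sup>2 - 3 * a\<^sup>2" for a b :: real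
      using zero_le_power2[of a] zero_le_power2[of b] by argo
    show "\<psi> u w \<ge> 3 / 4 * (x w)\<^sup>2 - 3 * (x u)\<^sup>2"
      using sq[of "x w" "x u"] sq'[of "x w" "x u"] by (cases "(u, w) \<in> parcs G") (simp_all add: \<psi>_def)
    show "\<psi> u w \<ge> 3 / 4 * (x u)\<^sup>2 - 3 * (x w)\<^sup>2"
      using sq[of "x u" "x w"] sq'[of "x u" "x w"] power2_commute[of "x u" "x w"] by (cases "(u, w) \<in> parcs G") (simp_all add: \<psi>_def)
  qed
  have "3 / 4 * (\<beta> u * ((1 - \<beta> w) * (x w)\<^sup>2) + \<beta> w * ((1 - \<beta> u) * (x u)\<^sup>2))
      + - 3 * (\<beta> u * (x u)\<^sup>2 * (1 - \<beta> w) + \<beta> w * (x w)\<^sup>2 * (1 - \<beta> u)) \<le> \<psi> u w" for u w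
    using \<beta>01[of u] \<beta>01[of w] low[of u w] low[of w u] \<psi>0[of u w] by (elim disjE) simp_all
  then have low_pair: "pair_sum (\<lambda>u w. 3 / 4 * (\<beta> u * ((1 - \<beta> w) * (x w)\<^sup>2) + \<beta> w * ((1 - \<beta> u) * (x u)\<^sup>2))
      + - 3 * (\<beta> u * (x u)\<^sup>2 * (1 - \<beta> w) + \<beta> w * (x w)\<^sup>2 * (1 - \<beta> u))) \<le> pair_sum \<psi>"
    unfolding pair_sum_def by (intro sum_mono)
  have \<beta>X: "(\<Sum>u\<in>S. (1 - \<beta> u) * (x u)\<^sup>2) = X - P"
    unfolding left_diff_distrib sum_subtractf \<beta>sum X_def P_def by simp
  have \<beta>P: "(\<Sum>u\<in>S. \<beta> u * (x u)\<^sup>2) = P" by (simp add: \<beta>sum P_def)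
  have \<beta>m: "(\<Sum>u\<in>S. 1 - \<beta> u) = real (card S) - 2" by (simp add: sum_subtractf \<beta>card)
  have zprod: "\<beta> u * h * (1 - \<beta> u) = 0" "\<beta> u * ((1 - \<beta> u) * h) = 0" for u h
    using \<beta>01[of u] by auto
  have low_sum: "3 * (X - P) - 6 * (P * (real (card S) - 2)) \<le> pair_sum \<psi>"
    using low_pair
    unfolding pair_sum_add pair_sum_mult pair_sum_prod pair_sum_prod_swapped zprod \<beta>X \<beta>P \<beta>m \<beta>card
    by (simp add: diff_divide_distrib)
  define W where "W = (\<Sum>u\<in>S. (real (card (outer u)) - real (codeg u)) * (x u)\<^sup>2)"
  have W0: "W \<ge> 0" unfolding W_def using excess e by (intro sum_nonneg mult_nonneg_nonneg) simp_all
  have Wt: "(\<Sum>u\<in>S. (real (card (outer u)) - real (codeg u) - 1) * (x u)\<^sup>2) = W - X"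
    unfolding W_def X_def sum_subtractf[symmetric]
    by (rule sum.cong[OF refl]) (simp add: algebra_simps)
  have at: "(\<Sum>u\<in>S. conn u r * h u) = h s" if "r \<in> T" "s \<in> S" "(s, r) \<in> parcs G" for r s and h :: "'a \<Rightarrow> real"
  proof -
    have "(\<Sum>u\<in>S. conn u r * h u) = (\<Sum>u\<in>S. if u = s then h s else 0)"
    proof (rule sum.cong[OF refl])
      fix u show "conn u r * h u = (if u = s then h s else 0)"
        using nbr[OF that(1) _ that(3), of u] that(3) by (cases "(u, r) \<in> parcs G") auto
    qed
    then show ?thesis using that(2) finite_S by simp
  qed
  have Tt: "(\<Sum>r\<in>T. ((\<Sum>u\<in>S. conn u r) - 1) * (x r)\<^sup>2 - 2 * x r * (\<Sum>u\<in>S. conn u r * x u)) = 2 * K * P"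
  proof -
    have "(\<Sum>r\<in>T. ((\<Sum>u\<in>S. conn u r) - 1) * (x r)\<^sup>2 - 2 * x r * (\<Sum>u\<in>S. conn u r * x u)) =
        (\<Sum>r\<in>T. (if r = p' then 2 * K * (x p)\<^sup>2 else 0) + (if r = q' then 2 * K * (x q)\<^sup>2 else 0))"
    proof (rule sum.cong[OF refl])
      fix r assume r: "r \<in> T"
      obtain s where s: "s \<in> S" "(s, r) \<in> parcs G" using pend[OF r] arcs_symmetric by blast
      have one: "(\<Sum>u\<in>S. conn u r) = 1" using at[OF r s, of "\<lambda>_. 1"] by simp
      have sp: "r = p' \<Longrightarrow> s = p" "r = q' \<Longrightarrow> s = q" using nbr[OF r s(2)] p(2) q(2) by blast+
      show "((\<Sum>u\<in>S. conn u r) - 1) * (x r)\<^sup>2 - 2 * x r * (\<Sum>u\<in>S. conn u r * x u) =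
          (if r = p' then 2 * K * (x p)\<^sup>2 else 0) + (if r = q' then 2 * K * (x q)\<^sup>2 else 0)"
        unfolding one at[OF r s] using sp xp' xq' x0[OF r] p'q'
        by (cases "r = p'"; cases "r = q'") (simp_all add: power2_eq_square)
    qed
    also have "\<dots> = 2 * K * (x p)\<^sup>2 + 2 * K * (x q)\<^sup>2"
      unfolding sum.distrib using p(2) q(2) finite_T by simp
    finally show ?thesis by (simp add: P_def algebra_simps)
  qed
  have id: "2 * (graph_energy G x - 1 * (\<Sum>v\<in>pverts G. (x v)\<^sup>2)) = pair_sum \<psi> + 2 * (W - X) + 2 * (2 * K * P)"
    unfolding energy_expansion Wt Tt \<psi>_def ..
  have P0: "P \<ge> 0" by (simp add: P_def)
  have "X \<le> 0"
  proof -
    define Q where "Q = P * real (card S)"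
    have KP: "2 * (2 * K * P) = 6 * Q" by (simp add: K_def Q_def)
    have "P * (real (card S) - 2) = Q - 2 * P" by (simp add: Q_def algebra_simps)
    with low_sum have "3 * (X - P) - 6 * (Q - 2 * P) \<le> pair_sum \<psi>" by (simp only:)
    then show ?thesis using id[unfolded KP] small W0 P0 by argo
  qed
  moreover have "X \<ge> 0" unfolding X_def by (intro sum_nonneg) simp
  ultimately have "X = 0" by (rule antisym)
  then have xS: "x u = 0" if "u \<in> S" for u
    using that finite_S unfolding X_def by (subst (asm) sum_nonneg_eq_0_iff) auto
  have "x r = 0" if "r \<in> T" for r
    using x0[OF that] xp' xq' xS[OF p(1)] xS[OF q(1)] by (metis mult_zero_right)
  then show False using nz xS by blast
qed

text \<open>
  In the second alternative \<open>S\<close> is the set of end vertices of a path on three vertices. The graph is then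
  a clique with a pendant vertex too, but the clique is not \<open>S\<close>.
\<close>

theorem zero_excess_structure:
  assumes e: "e = 0" and ne: "S \<noteq> {}" and le: "laplacian_eigenvalue G (card S) \<le> 1"
  shows "(clique_with_pendants G S \<and> (\<exists>w\<in>S. \<forall>u\<in>S - {w}. outer u = {})) \<or>
    (\<exists>u v w. u \<noteq> w \<and> pverts G = {u, v, w} \<and> S = {u, w} \<and> parcs G = {(u, v), (v, u), (w, v), (v, w)})"
proof (cases "\<exists>v\<in>T. \<exists>p q. (p, v) \<in> parcs G \<and> (q, v) \<in> parcs G \<and> p \<noteq> q")
  case True
  then obtain v p q where "v \<in> T" "(p, v) \<in> parcs G" "(q, v) \<in> parcs G" "p \<noteq> q" by blast
  from outer_vertex_with_two_neighbours[OF e le this] show ?thesis by blast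
next
  case False
  have pend: "\<exists>u\<in>S. {w. (v, w) \<in> parcs G} = {u}" if v: "v \<in> T" for v
  proof -
    obtain u where u: "(v, u) \<in> parcs G" using no_isolated v by blast
    have "w = u" if "(v, w) \<in> parcs G" for w using False v u that arcs_symmetric by blast
    then have "{w. (v, w) \<in> parcs G} = {u}" using u by blast
    then show ?thesis using T_neighbours[OF v u] by blast
  qed
  obtain w where w: "w \<in> S" "\<forall>u\<in>S - {w}. outer u = {}"
  proof (cases "\<exists>w\<in>S. outer w \<noteq> {}")
    case True
    then obtain w w' where w: "w \<in> S" "w' \<in> outer w" by blast
    have "outer u = {}" if u: "u \<in> S - {w}" for u
    proof (rule ccontr)
      assume "outer u \<noteq> {}"
      then obtain u' where "u' \<in> outer u" by blast
      then have "u = w" using pendants_at_one_vertex[OF le e pend _ _ w] u by blast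
      then show False using u by blast
    qed
    then show ?thesis using that w(1) by blast
  next
    case False
    then show ?thesis using that ne by blast
  qed
  have full: "(u, r) \<in> parcs G" if u: "u \<in> S" "u \<noteq> w" and r: "r \<in> S" "r \<noteq> u" for u r
  proof -
    have "outer u = {}" using w(2) u by blast
    then have "codeg u = 0" using excess[OF u(1)] e by (metis add_0 card.empty le_zero_eq)
    then have "{w \<in> S - {u}. (u, w) \<notin> parcs G} = {}" using finite_S by (simp only: card_eq_0_iff) auto
    then show ?thesis using r by blast
  qed
  have "(u, r) \<in> parcs G" if "u \<in> S" "r \<in> S" "u \<noteq> r" for u r
    using full[of u r] full[of r u] that arcs_symmetric by blast
  then have "clique_with_pendants G S"
    unfolding clique_with_pendants_def using S_subset pend by blast
  then show ?thesis using w by blast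
qed

end

section \<open>Recognising cliques with pendant vertices\<close>

lemma (in pair_graph) digraph_isoI_bij:
  assumes inj: "inj_on h (pverts G)" and V: "h ` pverts G = pverts H" and A: "map_prod h h ` parcs G = parcs H"
  shows "digraph_iso (with_proj G) (with_proj H)"
proof -
  let ?f = "\<lparr>iso_verts = h, iso_arcs = map_prod h h, iso_head = snd, iso_tail = fst\<rparr>"
  have wf: "wf_digraph (with_proj G)" by unfold_locales
  have "inj_on (map_prod h h) (parcs G)"
  proof (rule inj_on_subset)
    show "inj_on (map_prod h h) (pverts G \<times> pverts G)" using map_prod_inj_on[OF inj inj] .
    show "parcs G \<subseteq> pverts G \<times> pverts G" using in_arcsD1 in_arcsD2 by (intro subrelI) blast
  qed
  then have "pre_digraph.digraph_isomorphism (with_proj G) ?f"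
    unfolding pre_digraph.digraph_isomorphism_def using inj wf by simp
  moreover have "with_proj H = app_iso ?f (with_proj G)"
    unfolding app_iso_def using V A by (simp add: with_proj_def)
  ultimately show ?thesis unfolding digraph_iso_def by blast
qed

text \<open>
  The clique is numbered by \<open>b\<close>, and the pendant vertices at each clique vertex are numbered separately by \<open>ix\<close>.
  The numbering \<open>b\<close> is exposed so that the function \<open>k\<close> of pendant counts can be supplied in any form.
\<close>

lemma (in pair_graph) clique_with_pendants_iso:
  assumes cl: "clique_with_pendants G S"
  shows "\<exists>(H :: nat pair_pre_digraph) b. complete_digraph (card S) (with_proj H) \<and> bij_betw b S (pverts H) \<and>
    (\<forall>k. (\<forall>u\<in>S. k (b u) = card {v \<in> pverts G - S. (u, v) \<in> parcs G}) \<longrightarrow>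
      digraph_iso (with_proj G) (with_proj (attach_pendants H k)))"
proof -
  let ?T = "pverts G - S"
  define out where "out u = {v \<in> pverts G - S. (u, v) \<in> parcs G}" for u
  have SV: "S \<subseteq> pverts G" and clique: "\<And>u w. u \<in> S \<Longrightarrow> w \<in> S \<Longrightarrow> u \<noteq> w \<Longrightarrow> (u, w) \<in> parcs G"
    and pend: "\<forall>v\<in>?T. \<exists>u. u \<in> S \<and> {w. (v, w) \<in> parcs G} = {u}"
    using cl unfolding clique_with_pendants_def by blast+
  have finS: "finite S" using SV pair_finite_verts by (rule finite_subset)
  have finout: "finite (out u)" for u using pair_finite_verts by (simp add: out_def)
  define H :: "nat pair_pre_digraph" where
    "H = \<lparr>pverts = {0..<card S}, parcs = {(i, j). (i, j) \<in> {0..<card S} \<times> {0..<card S} \<and> i \<noteq> j}\<rparr>"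
  have H: "complete_digraph (card S) (with_proj H)"
    unfolding complete_digraph_pair_def H_def by simp
  obtain b where b: "bij_betw b S (pverts H)"
    using ex_bij_betw_finite_nat[OF finS] by (auto simp: H_def)
  have "\<exists>i. bij_betw i (out u) {0..<card (out u)}" for u
    using ex_bij_betw_finite_nat[OF finout] .
  then obtain ix where ix: "\<And>u. bij_betw (ix u) (out u) {0..<card (out u)}" by metis
  from bchoice[OF pend] obtain par where par: "\<forall>v\<in>?T. par v \<in> S \<and> {w. (v, w) \<in> parcs G} = {par v}" by blast
  have parS: "par v \<in> S" and v_out: "v \<in> out (par v)" and par_unique: "\<And>w. (v, w) \<in> parcs G \<Longrightarrow> w = par v"
    if "v \<in> ?T" for v
  proof -
    have eq: "{w. (v, w) \<in> parcs G} = {par v}" using par that by blast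
    then show "\<And>w. (v, w) \<in> parcs G \<Longrightarrow> w = par v" by blast
    show "par v \<in> S" using par that by blast
    have "(par v, v) \<in> parcs G" using eq arcs_symmetric by blast
    then show "v \<in> out (par v)" using that by (simp add: out_def)
  qed
  have out_par: "par v = u" "v \<in> ?T" if "v \<in> out u" for u v
  proof -
    show "v \<in> ?T" using that by (simp add: out_def)
    moreover have "(v, u) \<in> parcs G" using that arcs_symmetric by (simp add: out_def)
    ultimately show "par v = u" using par_unique by blast
  qed
  define h where "h v = (if v \<in> S then Inl (b v) else Inr (b (par v), ix (par v) v))" for v
  have inj_b: "b u = b w \<longleftrightarrow> u = w" if "u \<in> S" "w \<in> S" for u w
    using b that by (auto simp: bij_betw_def inj_on_def)
  have bS: "b ` S = pverts H" using b by (simp add: bij_betw_def)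
  have inj_ix: "v = w" if "v \<in> out u" "w \<in> out u" "ix u v = ix u w" for u v w
    using ix[of u] that by (auto simp: bij_betw_def inj_on_def)
  have ixS: "ix u ` out u = {0..<card (out u)}" for u using ix[of u] by (simp add: bij_betw_def)
  have inj: "inj_on h (pverts G)"
  proof (rule inj_onI)
    fix v w assume vw: "v \<in> pverts G" "w \<in> pverts G" "h v = h w"
    show "v = w"
    proof (cases "v \<in> S")
      case True
      then have "w \<in> S" using vw(3) by (simp add: h_def split: if_splits)
      then show ?thesis using True vw(3) inj_b by (simp add: h_def)
    next
      case False
      then have wS: "w \<notin> S" using vw(3) by (simp add: h_def split: if_splits)
      have T: "v \<in> ?T" "w \<in> ?T" using False wS vw by blast+
      have e: "b (par v) = b (par w)" "ix (par v) v = ix (par w) w" using vw(3) False wS by (simp_all add: h_def)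
      then have "par v = par w" using inj_b parS T by blast
      then show ?thesis using inj_ix[of v "par v" w] v_out[OF T(1)] v_out[OF T(2)] e(2) by simp
    qed
  qed
  have "digraph_iso (with_proj G) (with_proj (attach_pendants H k))"
    if k: "\<forall>u\<in>S. k (b u) = card (out u)" for k
  proof (rule digraph_isoI_bij[OF inj])
    have pendant_image: "\<exists>u\<in>S. \<exists>v\<in>out u. i = b u \<and> j = ix u v"
      if i: "i \<in> pverts H" and j: "j < k i" for i j
    proof -
      obtain u where u: "u \<in> S" "i = b u" using bS i by blast
      then have "j \<in> ix u ` out u" using j k ixS by simp
      then show ?thesis using u by blast
    qed
    have pendant_code: "b (par v) \<in> pverts H" "ix (par v) v < k (b (par v))" if v: "v \<in> ?T" for v
    proof -
      show "b (par v) \<in> pverts H" using bS parS[OF v] by blast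
      have "ix (par v) v \<in> {0..<card (out (par v))}" using ixS v_out[OF v] by blast
      then show "ix (par v) v < k (b (par v))" using k parS[OF v] by simp
    qed
    have h_out: "h v = Inr (b u, ix u v)" if "v \<in> out u" for u v
      using out_par[OF that] by (simp add: h_def)
    have h_S: "h u = Inl (b u)" if "u \<in> S" for u using that by (simp add: h_def)
    show "h ` pverts G = pverts (attach_pendants H k)"
    proof
      show "h ` pverts G \<subseteq> pverts (attach_pendants H k)"
      proof (rule image_subsetI)
        fix v assume v: "v \<in> pverts G"
        show "h v \<in> pverts (attach_pendants H k)"
        proof (cases "v \<in> S")
          case True
          then show ?thesis using bS h_S by (auto simp: attach_pendants_def)
        next
          case False
          then show ?thesis using pendant_code[of v] v by (simp add: attach_pendants_def h_def)
        qed
      qed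
      show "pverts (attach_pendants H k) \<subseteq> h ` pverts G"
      proof
        fix y assume "y \<in> pverts (attach_pendants H k)"
        then consider i where "y = Inl i" "i \<in> pverts H" | i j where "y = Inr (i, j)" "i \<in> pverts H" "j < k i"
          unfolding attach_pendants_def by auto
        then show "y \<in> h ` pverts G"
        proof cases
          case 1
          then obtain u where "u \<in> S" "i = b u" using bS by blast
          then show ?thesis using 1 h_S SV by (intro image_eqI[of _ _ u]) auto
        next
          case 2
          then obtain u v where "u \<in> S" "v \<in> out u" "i = b u" "j = ix u v" using pendant_image by blast
          then show ?thesis using 2 h_out out_par(2) by (intro image_eqI[of _ _ v]) auto
        qed
      qed
    qed
    show "map_prod h h ` parcs G = parcs (attach_pendants H k)"
    proof
      show "map_prod h h ` parcs G \<subseteq> parcs (attach_pendants H k)"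
      proof (rule image_subsetI)
        fix a assume "a \<in> parcs G"
        then obtain r s where a: "a = (r, s)" and rs: "(r, s) \<in> parcs G" by (cases a) blast
        have ne: "r \<noteq> s" and rV: "r \<in> pverts G" and sV: "s \<in> pverts G"
          using rs no_loops' in_arcsD1 in_arcsD2 by blast+
        have "(h r, h s) \<in> parcs (attach_pendants H k)"
        proof (cases "r \<in> S")
          case r: True
          show ?thesis
          proof (cases "s \<in> S")
            case True
            then have "(b r, b s) \<in> parcs H"
              using r ne bS inj_b[OF r True] by (auto simp: H_def)
            then show ?thesis using r True h_S by (simp add: attach_pendants_def)
          next
            case False
            then have s: "s \<in> ?T" using sV by blast
            have "par s = r" using par_unique[OF s] arcs_symmetric[OF rs] by blast
            then show ?thesis using pendant_code[OF s] r False by (simp add: attach_pendants_def h_def)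
          qed
        next
          case r: False
          then have rT: "r \<in> ?T" using rV by blast
          have "par r = s" using par_unique[OF rT rs] by simp
          moreover from this have "s \<in> S" using parS[OF rT] by simp
          ultimately show ?thesis using pendant_code[OF rT] r by (simp add: attach_pendants_def h_def)
        qed
        then show "map_prod h h a \<in> parcs (attach_pendants H k)" by (simp add: a)
      qed
      show "parcs (attach_pendants H k) \<subseteq> map_prod h h ` parcs G"
      proof
        fix y assume "y \<in> parcs (attach_pendants H k)"
        then consider i j where "y = (Inl i, Inl j)" "(i, j) \<in> parcs H"
          | i j where "y = (Inl i, Inr (i, j))" "i \<in> pverts H" "j < k i"
          | i j where "y = (Inr (i, j), Inl i)" "i \<in> pverts H" "j < k i"
          unfolding attach_pendants_def by auto
        then show "y \<in> map_prod h h ` parcs G"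
        proof cases
          case 1
          then have ij: "i \<in> b ` S" "j \<in> b ` S" "i \<noteq> j" unfolding bS by (simp_all add: H_def)
          then obtain u w where "u \<in> S" "i = b u" "w \<in> S" "j = b w" by blast
          then show ?thesis using 1 ij(3) clique[of u w] h_S by (intro image_eqI[of _ _ "(u, w)"]) auto
        next
          case 2
          then obtain u v where uv: "u \<in> S" "v \<in> out u" "i = b u" "j = ix u v" using pendant_image by blast
          then have "(u, v) \<in> parcs G" by (simp add: out_def)
          then show ?thesis using 2 uv h_S h_out by (intro image_eqI[of _ _ "(u, v)"]) auto
        next
          case 3
          then obtain u v where uv: "u \<in> S" "v \<in> out u" "i = b u" "j = ix u v" using pendant_image by blast
          then have "(v, u) \<in> parcs G" using arcs_symmetric by (simp add: out_def)
          then show ?thesis using 3 uv h_S h_out by (intro image_eqI[of _ _ "(v, u)"]) auto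
        qed
      qed
    qed
  qed
  then show ?thesis using H b unfolding out_def by blast
qed

lemma (in pair_graph) pendants_at_one_clique_vertex_iso:
  assumes cl: "clique_with_pendants G S" and w: "w \<in> S"
    and none: "\<And>u. u \<in> S - {w} \<Longrightarrow> {v \<in> pverts G - S. (u, v) \<in> parcs G} = {}"
  shows "\<exists>(p::nat) (H :: nat pair_pre_digraph) w'. complete_digraph (card S) (with_proj H) \<and> w' \<in> pverts H \<and>
    digraph_iso (with_proj G) (with_proj (attach_pendants H (\<lambda>v. if v = w' then p else 0)))"
proof -
  from clique_with_pendants_iso[OF cl] obtain H :: "nat pair_pre_digraph" and b where
    H: "complete_digraph (card S) (with_proj H)" and b: "bij_betw b S (pverts H)"
    and iso: "\<forall>k. (\<forall>u\<in>S. k (b u) = card {v \<in> pverts G - S. (u, v) \<in> parcs G}) \<longrightarrow>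
      digraph_iso (with_proj G) (with_proj (attach_pendants H k))" by blast
  let ?p = "card {v \<in> pverts G - S. (w, v) \<in> parcs G}"
  have "(if b u = b w then ?p else 0) = card {v \<in> pverts G - S. (u, v) \<in> parcs G}" if u: "u \<in> S" for u
  proof (cases "u = w")
    case False
    then have "b u \<noteq> b w" using b u w by (auto simp: bij_betw_def inj_on_def)
    moreover have "{v \<in> pverts G - S. (u, v) \<in> parcs G} = {}" using none u False by blast
    ultimately show ?thesis by (simp only: card.empty if_False)
  qed simp
  then have "digraph_iso (with_proj G) (with_proj (attach_pendants H (\<lambda>v. if v = b w then ?p else 0)))"
    using iso by simp
  moreover have "b w \<in> pverts H" using b w by (auto simp: bij_betw_def)
  ultimately show ?thesis using H by blast
qed

text \<open>
  The hypothesis \<open>m \<le> degree_seq G m + 1\<close> makes the truncated subtraction exact.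
\<close>

lemma nexus_covered_graph:
  assumes "pair_graph G" and nex: "nexus G m S" and le: "m \<le> degree_seq G m + 1"
  shows "covered_graph G S (degree_seq G m + 1 - m)"
proof -
  interpret pair_graph G by fact
  let ?d = "degree_seq G m"
  have S: "S \<subseteq> pverts G" "card S = m"
    and iso: "\<And>v. v \<in> pverts G \<Longrightarrow> out_degree (with_proj G) v \<noteq> 0"
    and deg: "\<And>v. v \<in> S \<Longrightarrow> ?d \<le> out_degree (with_proj G) v"
    and cov: "\<And>u v. (u, v) \<in> parcs G \<Longrightarrow> u \<in> S \<or> v \<in> S"
    using nex unfolding nexus_def by blast+
  have fin: "finite S" using S(1) pair_finite_verts by (rule finite_subset)
  show ?thesis
  proof (intro covered_graph.intro[OF assms(1)] covered_graph_axioms.intro)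
    show "S \<subseteq> pverts G" by (rule S(1))
    show "u \<in> S \<or> v \<in> S" if "(u, v) \<in> parcs G" for u v using cov that .
    show "\<exists>w. (v, w) \<in> parcs G" if "v \<in> pverts G" for v
    proof (rule ccontr)
      assume "\<nexists>w. (v, w) \<in> parcs G"
      then have "{w. (v, w) \<in> parcs G} = {}" by blast
      then show False using iso[OF that] unfolding out_degree_eq_card_neighbours by (simp only: card.empty)
    qed
    fix u assume u: "u \<in> S"
    let ?in = "{w \<in> S - {u}. (u, w) \<in> parcs G}" and ?non = "{w \<in> S - {u}. (u, w) \<notin> parcs G}"
      and ?out = "{v \<in> pverts G - S. (u, v) \<in> parcs G}"
    have "S = insert u (?in \<union> ?non)" using u by blast
    moreover have "card (insert u (?in \<union> ?non)) = Suc (card ?in + card ?non)"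
      using fin by (subst card_insert_disjoint) (auto intro!: card_Un_disjoint)
    ultimately have m: "m = Suc (card ?in + card ?non)" using S(2) by (simp only:)
    have "{w. (u, w) \<in> parcs G} = ?in \<union> ?out" using in_arcsD2 no_loops' S(1) by blast
    moreover have "card (?in \<union> ?out) = card ?in + card ?out"
      using fin pair_finite_verts by (intro card_Un_disjoint) auto
    ultimately have "?d \<le> card ?in + card ?out" using deg[OF u] unfolding out_degree_eq_card_neighbours by (simp only:)
    then show "?d + 1 - m + card ?non \<le> card ?out" using m le by linarith
  qed
qed

theorem theorem2p4:
  fixes G :: "'a pair_pre_digraph" and n m :: nat
  assumes "pair_graph G"
    and "card (pverts G) = n"
    and "m \<in> {1..n}"
    and "\<exists>S. nexus G m S"
    and "laplacian_eigenvalue G m = real (degree_seq G m) - real m + 2"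
    and "real (degree_seq G m) - real m + 2 \<ge> 1"
  shows
    "(laplacian_eigenvalue G m = 1 \<and>
       (\<exists>(p::nat) (H :: nat pair_pre_digraph) w.
          complete_digraph m (with_proj H) \<and> w \<in> pverts H \<and>
          digraph_iso (with_proj G)
            (with_proj (attach_pendants H (\<lambda>v. if v = w then p else 0)))))
     \<or> (laplacian_eigenvalue G m \<ge> 2 \<and>
       (\<exists>(k::nat) (H :: nat pair_pre_digraph).
          real k = laplacian_eigenvalue G m - 1 \<and>
          complete_digraph m (with_proj H) \<and>
          digraph_iso (with_proj G) (with_proj (attach_pendants H (\<lambda>v. k)))))
     \<or> (m = 2 \<and>
       (\<exists>d::nat. d \<ge> 2 \<and> laplacian_eigenvalue G m = real d \<and>
          complete_bipartite_digraph 2 d (with_proj G)))"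
proof -
  obtain S where nex: "nexus G m S" using assms(4) by blast
  define e where "e = degree_seq G m + 1 - m"
  have le: "m \<le> degree_seq G m + 1" using assms(6) by linarith
  have \<mu>: "laplacian_eigenvalue G m = real e + 1" using assms(5) le by (simp add: e_def of_nat_diff)
  interpret covered_graph G S e
    unfolding e_def by (rule nexus_covered_graph[OF assms(1) nex le])
  have m: "card S = m" using nex by (simp add: nexus_def)
  have ne: "S \<noteq> {}" using m assms(3) by auto
  have ev: "laplacian_eigenvalue G (card S) \<le> real e + 1" using \<mu> m by simp
  show ?thesis
  proof (cases "e = 0")
    case True
    have "\<exists>(p::nat) (H :: nat pair_pre_digraph) w. complete_digraph m (with_proj H) \<and> w \<in> pverts H \<and>
        digraph_iso (with_proj G) (with_proj (attach_pendants H (\<lambda>v. if v = w then p else 0)))"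
      using zero_excess_structure[OF True ne ev[unfolded True of_nat_0 add_0]]
    proof (elim disjE conjE exE bexE)
      fix w assume "clique_with_pendants G S" "w \<in> S" "\<forall>u\<in>S - {w}. outer u = {}"
      then show ?thesis using pendants_at_one_clique_vertex_iso[of S w] unfolding m by blast
    next
      \<comment> \<open>the path on three vertices: its middle vertex \<open>v\<close> and its end vertex \<open>u\<close> form the clique, and \<open>w\<close> is pendant\<close>
      fix u v w assume path: "u \<noteq> w" "pverts G = {u, v, w}" "S = {u, w}" "parcs G = {(u, v), (v, u), (w, v), (v, w)}"
      have "(u, v) \<in> parcs G" "(w, v) \<in> parcs G" using path(4) by blast+
      then have vs: "u \<noteq> v" "w \<noteq> v" using no_loops' by blast+
      have T: "pverts G - {v, u} = {w}" using path(1,2) vs by blast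
      have nw: "{r. (w, r) \<in> parcs G} = {v}" unfolding path(4) using path(1) vs by blast
      have cl: "clique_with_pendants G {v, u}"
        unfolding clique_with_pendants_def T using path nw by simp
      have none: "{r \<in> pverts G - {v, u}. (s, r) \<in> parcs G} = {}" if "s \<in> {v, u} - {v}" for s
        unfolding T path(4) using that path(1) vs by blast
      have cm: "card {v, u} = m" using path(1,3) m vs by simp
      show ?thesis using pendants_at_one_clique_vertex_iso[OF cl insertI1 none] unfolding cm .
    qed
    then show ?thesis using \<mu> True by simp
  next
    case False
    then have "e \<ge> 1" by simp
    from positive_excess_structure[OF this ne ev] show ?thesis
    proof (elim disjE conjE)
      assume cl: "clique_with_pendants G S" and out: "\<forall>u\<in>S. card (outer u) = e"
      from clique_with_pendants_iso[OF cl] obtain H :: "nat pair_pre_digraph" and b where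
        "complete_digraph (card S) (with_proj H)"
        and iso: "\<forall>k. (\<forall>u\<in>S. k (b u) = card (outer u)) \<longrightarrow>
          digraph_iso (with_proj G) (with_proj (attach_pendants H k))" by blast
      moreover have "digraph_iso (with_proj G) (with_proj (attach_pendants H (\<lambda>v. e)))"
        using iso out by simp
      moreover have "laplacian_eigenvalue G m \<ge> 2" "real e = laplacian_eigenvalue G m - 1" using \<mu> \<open>e \<ge> 1\<close> by simp_all
      ultimately show ?thesis unfolding m by blast
    next
      assume K: "card S = 2" "card T = e + 1" "parcs G = S \<times> T \<union> T \<times> S"
      have "complete_bipartite_digraph 2 (e + 1) (with_proj G)"
      proof -
        have "pverts G = S \<union> T" "S \<inter> T = {}" using S_subset by blast+
        then show ?thesis
          unfolding complete_bipartite_digraph_pair_def using K pair_finite_verts by blast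
      qed
      moreover have "laplacian_eigenvalue G m = real (e + 1)" "e + 1 \<ge> 2" using \<mu> \<open>e \<ge> 1\<close> by simp_all
      ultimately show ?thesis using K(1) m by blast
    qed
  qed
qed

end
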